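(* Let $\alpha_0,\dots,\alpha_6$ be complex parameters with $\alpha_0+\alpha_1+2\alpha_2+2\alpha_3+2\alpha_4+\alpha_5+\alpha_6=1$, and consider the Hamiltonian system $$\frac{dx}{dt}=\frac{\partial H}{\partial y},\ \frac{dy}{dt}=-\frac{\partial H}{\partial x},\ \frac{dz}{dt}=\frac{\partial H}{\partial w},\ \frac{dw}{dt}=-\frac{\partial H}{\partial z},\ \frac{dq}{dt}=\frac{\partial H}{\partial p},\ \frac{dp}{dt}=-\frac{\partial H}{\partial q}$$ with $$\begin{aligned} tH={}&x^2(y-1)y+x\{(\alpha_0+\alpha_1)y-\alpha_1\}+ty+z^2(w-1)w+z\{(\alpha_0+\alpha_1+2\alpha_2+2\alpha_3)w-\alpha_3\}+tw\\&+q^2(p-t)p+q\{(\alpha_5+\alpha_6-1)p-t\alpha_5\}+p+2yz(zw+\alpha_3)-2(y+w)p.\end{aligned}$$ This system admits extended affine Weyl group symmetry of type $D_6^{(1)}$ as a group of Bäcklund transformations, with generators given, in the notation $( * ):=(x,y,z,w,q,p,t;\alpha_0,\dots,\alpha_6)$, by $$\begin{aligned} s_0:( * )&\to\left(x+\tfrac{\alpha_0}{y-1},y,z,w,q,p,t;-\alpha_0,\alpha_1,\alpha_2+\alpha_0,\alpha_3,\alpha_4,\alpha_5,\alpha_6\right),\\ s_1:( * )&\to\left(x+\tfrac{\alpha_1}{y},y,z,w,q,p,t;\alpha_0,-\alpha_1,\alpha_2+\alpha_1,\alpha_3,\alpha_4,\alpha_5,\alpha_6\right),\\ s_2:( * )&\to\left(x,y-\tfrac{\alpha_2}{x-z},z,w+\tfrac{\alpha_2}{x-z},q,p,t;\alpha_0+\alpha_2,\alpha_1+\alpha_2,-\alpha_2,\alpha_3+\alpha_2,\alpha_4,\alpha_5,\alpha_6\right),\\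 s_3:( * )&\to\left(x,y,z+\tfrac{\alpha_3}{w},w,q,p,t;\alpha_0,\alpha_1,\alpha_2+\alpha_3,-\alpha_3,\alpha_4+\alpha_3,\alpha_5,\alpha_6\right),\\ s_4:( * )&\to\left(x,y,z,w-\tfrac{\alpha_4q}{zq-1},q,p-\tfrac{\alpha_4z}{zq-1},t;\alpha_0,\alpha_1,\alpha_2,\alpha_3+\alpha_4,-\alpha_4,\alpha_5+\alpha_4,\alpha_6+\alpha_4\right),\\ s_5:( * )&\to\left(x,y,z,w,q+\tfrac{\alpha_5}{p},p,t;\alpha_0,\alpha_1,\alpha_2,\alpha_3,\alpha_4+\alpha_5,-\alpha_5,\alpha_6\right),\\ s_6:( * )&\to\left(x,y,z,w,q+\tfrac{\alpha_6}{p-t},p,t;\alpha_0,\alpha_1,\alpha_2,\alpha_3,\alpha_4+\alpha_6,\alpha_5,-\alpha_6\right),\\ \pi_1:( * )&\to(-x,1-y,-z,-w,-q,t-p,t;\alpha_1,\alpha_0,\alpha_2,\alpha_3,\alpha_4,\alpha_6,\alpha_5),\\ \pi_2:( * )&\to\left(tq,\tfrac{p}{t},\tfrac{t}{z},-\tfrac{(zw+\alpha_3)z}{t},\tfrac{x}{t},ty,t;\alpha_6,\alpha_5,\alpha_4,\alpha_3,\alpha_2,\alpha_1,\alpha_0\right),\\ \pi_3:( * )&\to(x,y,z,w,q,p-t,-t;\alpha_0,\alpha_1,\alpha_2,\alpha_3,\alpha_4,\alpha_6,\alpha_5),\\ \pi_4:( * )&\to(-x,1-y,-z,-w,-q,-p,-t;\alpha_1,\alpha_0,\alpha_2,\alpha_3,\alpha_4,\alpha_5,\alpha_6).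 \end{aligned}$$ That is: each of $s_0,\dots,s_6,\pi_1,\dots,\pi_4$ is a Bäcklund transformation of the system; $s_0,\dots,s_6$ satisfy the defining relations of the affine Weyl group of type $D_6^{(1)}$; and $\pi_1,\dots,\pi_4$ act on them as automorphisms of the Dynkin diagram.
   Context: The unknowns are complex functions $x,y,z,w,q,p$ of $t$. A Bäcklund transformation of the system is a birational transformation $s$ of $(x,y,z,w,q,p,t)$ (rational in the parameters; here $s(t)=\pm t$), together with an affine transformation of the parameters, that maps the system to itself: whenever $(x,\dots,p)$ solves the system with parameters $\alpha_i$, the functions $s(x),\dots,s(p)$, as functions of $s(t)$, solve the same system with $\alpha_i$ replaced by $s(\alpha_i)$. Transformations act as automorphisms of the field of rational functions in $x,y,z,w,q,p,t,\alpha_i$ and products are compositions. Dynkin diagram of type $D_6^{(1)}$: nodes $0,\dots,6$, with simple edges $0-2,\ 1-2,\ 2-3,\ 3-4,\ 4-5,\ 4-6$. Defining relations of the affine Weyl group: $s_i^2=1$; $(s_is_j)^3=1$ if $i,j$ are joined by an edge; $(s_is_j)^2=1$ for $i\ne j$ not joined. The $\pi_j$ act by $\pi_js_i\pi_j^{-1}=s_{\sigma_j(i)}$, where $\sigma_1=(0\,1)(5\,6)$, $\sigma_2:i\mapsto 6-i$, $\sigma_3=(5\,6)$, $\sigma_4=(0\,1)$. *)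

theory Defs
  imports "HOL-Analysis.Analysis" "HOL-Library.Poly_Mapping"
    "HOL-Computational_Algebra.Fraction_Field"
begin

section \<open>The Hamiltonian system\<close>

text \<open>Parameters are given as a function \<open>a\<close> on \<open>nat\<close> of which only
  \<open>a 0, \<dots>, a 6\<close> are used.\<close>

definition normalized :: "(nat \<Rightarrow> complex) \<Rightarrow> bool" where
  "normalized a \<longleftrightarrow> a 0 + a 1 + 2 * a 2 + 2 * a 3 + 2 * a 4 + a 5 + a 6 = 1"

definition hamiltonian ::
  "(nat \<Rightarrow> complex) \<Rightarrow> complex \<Rightarrow> complex \<Rightarrow> complex \<Rightarrow> complex \<Rightarrow> complex \<Rightarrow> complex \<Rightarrow> complex \<Rightarrow> complex"
  where
  "hamiltonian a t x y z w q p =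
    (x^2 * (y - 1) * y + x * ((a 0 + a 1) * y - a 1) + t * y
     + z^2 * (w - 1) * w + z * ((a 0 + a 1 + 2 * a 2 + 2 * a 3) * w - a 3) + t * w
     + q^2 * (p - t) * p + q * ((a 5 + a 6 - 1) * p - t * a 5) + p
     + 2 * y * z * (z * w + a 3) - 2 * (y + w) * p) / t"

text \<open>The Hamiltonian is \<open>(tH)/t\<close>, so the system lives on \<open>t \<noteq> 0\<close>; solutions are holomorphic
  functions on an open set avoiding the origin (not necessarily connected).\<close>

definition solves ::
  "(nat \<Rightarrow> complex) \<Rightarrow> complex set \<Rightarrow> (complex \<Rightarrow> complex) \<Rightarrow> (complex \<Rightarrow> complex) \<Rightarrow> (complex \<Rightarrow> complex)
    \<Rightarrow> (complex \<Rightarrow> complex) \<Rightarrow> (complex \<Rightarrow> complex) \<Rightarrow> (complex \<Rightarrow> complex) \<Rightarrow> bool"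
  where
  "solves a S x y z w q p \<longleftrightarrow>
    normalized a \<and> open S \<and> S \<noteq> {} \<and> 0 \<notin> S \<and>
    (\<forall>t\<in>S.
      (x has_field_derivative deriv (\<lambda>u. hamiltonian a t (x t) u (z t) (w t) (q t) (p t)) (y t)) (at t) \<and>
      (y has_field_derivative - deriv (\<lambda>u. hamiltonian a t u (y t) (z t) (w t) (q t) (p t)) (x t)) (at t) \<and>
      (z has_field_derivative deriv (\<lambda>u. hamiltonian a t (x t) (y t) (z t) u (q t) (p t)) (w t)) (at t) \<and>
      (w has_field_derivative - deriv (\<lambda>u. hamiltonian a t (x t) (y t) u (w t) (q t) (p t)) (z t)) (at t) \<and>
      (q has_field_derivative deriv (\<lambda>u. hamiltonian a t (x t) (y t) (z t) (w t) (q t) u) (p t)) (at t) \<and>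
      (p has_field_derivative - deriv (\<lambda>u. hamiltonian a t (x t) (y t) (z t) (w t) u (p t)) (q t)) (at t))"

section \<open>The field of rational functions\<close>

text \<open>The parameters are subject to one affine relation, so the coordinate field is the field of
  rational functions in the thirteen independent indeterminates
  \<open>x, y, z, w, q, p, t, \<alpha>\<^sub>1, \<dots>, \<alpha>\<^sub>6\<close>, and \<open>\<alpha>\<^sub>0\<close> is the element determined by the relation
  (see \<open>alpha\<close> below).\<close>

datatype indet = X | Y | Z | W | Q | P | T | A1 | A2 | A3 | A4 | A5 | A6

text \<open>Some linear order on the indeterminates is needed for the polynomial ring to be recognised
  as an integral domain; it plays no other role.\<close>

fun indet_index :: "indet \<Rightarrow> nat" where
  "indet_index X = 0" | "indet_index Y = 1" | "indet_index Z = 2" | "indet_index W = 3"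
| "indet_index Q = 4" | "indet_index P = 5" | "indet_index T = 6" | "indet_index A1 = 7"
| "indet_index A2 = 8" | "indet_index A3 = 9" | "indet_index A4 = 10" | "indet_index A5 = 11"
| "indet_index A6 = 12"

lemma indet_index_inject: "indet_index u = indet_index v \<Longrightarrow> u = v"
  by (cases u; cases v) simp_all

instantiation indet :: linorder
begin

definition "u \<le> v \<longleftrightarrow> indet_index u \<le> indet_index v"
definition "u < v \<longleftrightarrow> indet_index u < indet_index v"

instance
  by standard (auto simp: less_eq_indet_def less_indet_def intro: indet_index_inject)

end

type_synonym mpoly = "(indet \<Rightarrow>\<^sub>0 nat) \<Rightarrow>\<^sub>0 complex"
type_synonym ratfun = "mpoly fract"

definition rconst :: "complex \<Rightarrow> ratfun" where
  "rconst c = Fract (Poly_Mapping.single 0 c) 1"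

definition rvar :: "indet \<Rightarrow> ratfun" where
  "rvar v = Fract (Poly_Mapping.single (Poly_Mapping.single v 1) 1) 1"

definition "xx = rvar X"
definition "yy = rvar Y"
definition "zz = rvar Z"
definition "ww = rvar W"
definition "qq = rvar Q"
definition "pp = rvar P"
definition "tt = rvar T"

definition alpha :: "nat \<Rightarrow> ratfun" where
  "alpha i =
    (if i = 0 then 1 - rvar A1 - 2 * rvar A2 - 2 * rvar A3 - 2 * rvar A4 - rvar A5 - rvar A6
     else rvar ([A1, A2, A3, A4, A5, A6] ! (i - 1)))"

text \<open>The tuple \<open>(*) = (x, y, z, w, q, p, t; \<alpha>\<^sub>0, \<dots>, \<alpha>\<^sub>6)\<close>.\<close>

definition coords :: "ratfun list" where
  "coords = [xx, yy, zz, ww, qq, pp, tt,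
     alpha 0, alpha 1, alpha 2, alpha 3, alpha 4, alpha 5, alpha 6]"

definition mpoly_eval :: "(indet \<Rightarrow> complex) \<Rightarrow> mpoly \<Rightarrow> complex" where
  "mpoly_eval e f =
    (\<Sum>m\<in>Poly_Mapping.keys f. Poly_Mapping.lookup f m *
       (\<Prod>v\<in>Poly_Mapping.keys m. e v ^ Poly_Mapping.lookup m v))"

text \<open>\<open>has_value r e c\<close>: the rational function \<open>r\<close> is regular at the point \<open>e\<close>, i.e. it has some
  representation whose denominator does not vanish there, and takes the value \<open>c\<close>.\<close>

definition has_value :: "ratfun \<Rightarrow> (indet \<Rightarrow> complex) \<Rightarrow> complex \<Rightarrow> bool" where
  "has_value r e c \<longleftrightarrow>
    (\<exists>f g. r = Fract f g \<and> mpoly_eval e g \<noteq> 0 \<and> c = mpoly_eval e f / mpoly_eval e g)"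

fun point ::
  "(nat \<Rightarrow> complex) \<Rightarrow> complex \<Rightarrow> complex \<Rightarrow> complex \<Rightarrow> complex \<Rightarrow> complex \<Rightarrow> complex \<Rightarrow> complex
    \<Rightarrow> indet \<Rightarrow> complex"
  where
  "point a t x y z w q p X = x" | "point a t x y z w q p Y = y"
| "point a t x y z w q p Z = z" | "point a t x y z w q p W = w"
| "point a t x y z w q p Q = q" | "point a t x y z w q p P = p"
| "point a t x y z w q p T = t"
| "point a t x y z w q p A1 = a 1" | "point a t x y z w q p A2 = a 2"
| "point a t x y z w q p A3 = a 3" | "point a t x y z w q p A4 = a 4"
| "point a t x y z w q p A5 = a 5" | "point a t x y z w q p A6 = a 6"

section \<open>Baecklund transformations\<close>

text \<open>A birational transformation of the extended space of variables and parameters is a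
  \<open>\<complex>\<close>-automorphism of its function field; it is determined by its values on \<open>coords\<close>.
  Products of transformations are compositions of automorphisms.\<close>

definition field_aut :: "(ratfun \<Rightarrow> ratfun) \<Rightarrow> bool" where
  "field_aut \<phi> \<longleftrightarrow> bij \<phi> \<and> (\<forall>f g. \<phi> (f + g) = \<phi> f + \<phi> g) \<and> (\<forall>f g. \<phi> (f * g) = \<phi> f * \<phi> g) \<and>
     (\<forall>c. \<phi> (rconst c) = rconst c)"

text \<open>In the last clause, \<open>\<theta> t\<close> is the value of \<open>\<phi>(t)\<close> along the given solution and the transformed
  functions \<open>x', \<dots>, p'\<close> are the values of \<open>\<phi>(x), \<dots>, \<phi>(p)\<close> regarded as functions of \<open>\<theta> t\<close>;
  \<open>b\<close> holds the transformed parameters. The solution is considered on a set where all these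
  rational functions are regular along it.\<close>

definition backlund :: "(ratfun \<Rightarrow> ratfun) \<Rightarrow> bool" where
  "backlund \<phi> \<longleftrightarrow>
    field_aut \<phi> \<and>
    (\<phi> tt = tt \<or> \<phi> tt = - tt) \<and>
    (\<forall>i\<le>6. \<exists>c k. \<phi> (alpha i) = rconst c + (\<Sum>j\<le>6. rconst (k j) * alpha j)) \<and>
    (\<forall>a S x y z w q p b \<theta> x' y' z' w' q' p'.
       solves a S x y z w q p \<longrightarrow>
       (\<forall>t\<in>S. let e = point a t (x t) (y t) (z t) (w t) (q t) (p t) in
          has_value (\<phi> tt) e (\<theta> t) \<and>
          has_value (\<phi> xx) e (x' (\<theta> t)) \<and> has_value (\<phi> yy) e (y' (\<theta> t)) \<and>
          has_value (\<phi> zz) e (z' (\<theta> t)) \<and> has_value (\<phi> ww) e (w' (\<theta> t)) \<and>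
          has_value (\<phi> qq) e (q' (\<theta> t)) \<and> has_value (\<phi> pp) e (p' (\<theta> t)) \<and>
          (\<forall>i\<le>6. has_value (\<phi> (alpha i)) e (b i))) \<longrightarrow>
       solves b (\<theta> ` S) x' y' z' w' q' p')"

section \<open>The affine Weyl group of type \<open>D\<^sub>6\<^sup>(\<^sup>1\<^sup>)\<close>\<close>

definition D6_adj :: "nat \<Rightarrow> nat \<Rightarrow> bool" where
  "D6_adj i j \<longleftrightarrow> (let E = {(0,2), (1,2), (2,3), (3,4), (4,5), (4,6)} in (i, j) \<in> E \<or> (j, i) \<in> E)"

definition D6_relations :: "(nat \<Rightarrow> 'a \<Rightarrow> 'a) \<Rightarrow> bool" where
  "D6_relations s \<longleftrightarrow>
    (\<forall>i\<le>6. s i ^^ 2 = id) \<and>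
    (\<forall>i\<le>6. \<forall>j\<le>6. D6_adj i j \<longrightarrow> (s i \<circ> s j) ^^ 3 = id) \<and>
    (\<forall>i\<le>6. \<forall>j\<le>6. i \<noteq> j \<and> \<not> D6_adj i j \<longrightarrow> (s i \<circ> s j) ^^ 2 = id)"

definition D6_diagram_aut :: "(nat \<Rightarrow> nat) \<Rightarrow> bool" where
  "D6_diagram_aut \<sigma> \<longleftrightarrow> bij_betw \<sigma> {..6} {..6} \<and> (\<forall>i\<le>6. \<forall>j\<le>6. D6_adj (\<sigma> i) (\<sigma> j) \<longleftrightarrow> D6_adj i j)"

definition diagram_perm :: "nat \<Rightarrow> nat \<Rightarrow> nat" where
  "diagram_perm j =
    (if j = 1 then id(0 := 1, 1 := 0, 5 := 6, 6 := 5)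
     else if j = 2 then (\<lambda>i. 6 - i)
     else if j = 3 then id(5 := 6, 6 := 5)
     else id(0 := 1, 1 := 0))"

end

theory Submission
  imports Defs
begin

text \<open>
The statement has three parts: the eleven tuples define automorphisms of the function field, these
satisfy the relations of the extended affine Weyl group, and they carry solutions to solutions.

Substituting rational functions for the indeterminates always gives a ring homomorphism from
polynomials to the function field, but it extends to fractions only if no nonzero polynomial is
sent to \<open>0\<close>. Here this follows from the fact that all eleven tuples are involutive:
substituting a tuple into its own entries gives back the coordinates. Hence each polynomial can be
recovered from its image (\<open>val_spec\<close>), so the substitution is injective, extends to the field, and
is its own inverse there (\<open>subst_subst\<close>, \<open>field_aut_subst\<close>).

An automorphism is determined by its values on \<open>coords\<close> (\<open>field_aut_ext\<close>), so each relation is a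
list of identities between explicit rational functions. Since the generators are involutions, it is
enough to show that generators without an edge commute, that joined ones satisfy
\<open>s\<^sub>i s\<^sub>j s\<^sub>i = s\<^sub>j s\<^sub>i s\<^sub>j\<close>, and that \<open>\<pi>\<^sub>j s\<^sub>i = s\<^bsub>\<sigma>(i)\<^esub> \<pi>\<^sub>j\<close>
with \<open>\<sigma> = \<sigma>\<^sub>j\<close>. The six braid relations are instances
of a single computation, \<open>braid_identities\<close>.

For the solutions, let \<open>f\<^sub>i\<close> be the denominator in \<open>s\<^sub>i\<close>, namely
\<open>y - 1, y, x - z, w, z q - 1, p, p - t\<close> for \<open>i = 0, \<dots>, 6\<close>. The transformation \<open>s\<^sub>i\<close> is the
canonical transformation that moves each variable by \<open>\<plusminus>\<alpha>\<^sub>i\<close> times the derivative of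
\<open>log f\<^sub>i\<close> in the conjugate variable, and along the flow the derivative of \<open>f\<^sub>i\<close> is a multiple
of \<open>\<alpha>\<^sub>i\<close> wherever \<open>f\<^sub>i = 0\<close>; this is why the poles that the shift could introduce into the
vector field along \<open>f\<^sub>i = 0\<close> cancel. Concretely, once \<open>f\<^sub>i \<noteq> 0\<close> is known, the new functions are
given by the explicit formulas, and differentiating them leaves an identity of rational functions,
which is verified by expanding both sides (\<open>flow_images\<close>). That
\<open>f\<^sub>i\<close> does not vanish is hidden in the regularity hypothesis and needs an argument, because
\<open>\<alpha>\<^sub>i\<close> may be \<open>0\<close> at the point in question (\<open>denominator_nonzero\<close>).
\<close>

section \<open>Evaluating rational functions in a field\<close>

lemma rvar_conv:
  "rvar X = xx" "rvar Y = yy" "rvar Z = zz" "rvar W = ww" "rvar Q = qq" "rvar P = pp" "rvar T = tt"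
  "rvar A1 = alpha 1" "rvar A2 = alpha 2" "rvar A3 = alpha 3" "rvar A4 = alpha 4"
  "rvar A5 = alpha 5" "rvar A6 = alpha 6"
  by (simp_all add: xx_def yy_def zz_def ww_def qq_def pp_def tt_def alpha_def)

lemma alpha_0_eq: "alpha 0 = 1 - alpha 1 - 2 * alpha 2 - 2 * alpha 3 - 2 * alpha 4 - alpha 5 - alpha 6"
  by (simp add: alpha_def)

lemma finite_UNIV_indet: "finite (UNIV :: indet set)"
proof -
  have "v \<in> {X, Y, Z, W, Q, P, T, A1, A2, A3, A4, A5, A6}" for v by (cases v) auto
  then have "UNIV = {X, Y, Z, W, Q, P, T, A1, A2, A3, A4, A5, A6}" by blast
  then show ?thesis using finite.simps by auto
qed

lemma poly_mapping_sum_single: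
  "f = (\<Sum>m\<in>Poly_Mapping.keys f. Poly_Mapping.single m (Poly_Mapping.lookup f m))"
  by (rule poly_mapping_eqI)
     (auto simp: lookup_sum lookup_single when_def sum.delta in_keys_iff)

definition pconst :: "complex \<Rightarrow> mpoly" where
  "pconst c = Poly_Mapping.single 0 c"

definition pvar :: "indet \<Rightarrow> mpoly" where
  "pvar v = Poly_Mapping.single (Poly_Mapping.single v 1) 1"

lemma pvar_power: "pvar v ^ n = Poly_Mapping.single (Poly_Mapping.single v n) 1"
  by (induction n) (auto simp: pvar_def mult_single single_add[symmetric] single_zero simp flip: single_one)

lemma prod_single:
  "finite A \<Longrightarrow> (\<Prod>v\<in>A. Poly_Mapping.single (h v) (1::complex)) = Poly_Mapping.single (\<Sum>v\<in>A. h v) 1"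
  by (induction A rule: finite_induct) (auto simp: mult_single simp flip: single_one)

lemma single_eq_monomial:
  "Poly_Mapping.single m c = pconst c * (\<Prod>v\<in>Poly_Mapping.keys m. pvar v ^ Poly_Mapping.lookup m v)"
  using poly_mapping_sum_single[of m, symmetric]
  by (simp add: pvar_power prod_single pconst_def mult_single)

lemma mpoly_induct [case_names const var add mult]:
  assumes const: "\<And>c. R (pconst c)" and var: "\<And>v. R (pvar v)"
    and add: "\<And>f g. R f \<Longrightarrow> R g \<Longrightarrow> R (f + g)" and mult: "\<And>f g. R f \<Longrightarrow> R g \<Longrightarrow> R (f * g)"
  shows "R f"
proof -
  have one: "R 1" using const[of 1] by (simp add: pconst_def)
  have zero: "R 0" using const[of 0] by (simp add: pconst_def)
  have power: "R (pvar v ^ n)" for v n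
    by (induction n) (auto intro: one var mult)
  have prod: "R (\<Prod>v\<in>A. pvar v ^ h v)" if "finite A" for A h
    using that by (induction A rule: finite_induct) (auto intro: one power mult)
  have mono: "R (Poly_Mapping.single m c)" for m c
    unfolding single_eq_monomial by (intro mult const prod) simp
  have "R (\<Sum>m\<in>A. Poly_Mapping.single m (h m))" if "finite A" for A h
    using that by (induction A rule: finite_induct) (auto intro: zero mono add)
  then show ?thesis using poly_mapping_sum_single[of f] by (metis finite_keys)
qed

text \<open>Two instances matter: with \<open>\<kappa> = rconst\<close> this is substitution of rational functions for the
indeterminates, with \<open>\<kappa>\<close> the identity it is evaluation at a point. Treating them together gives
the calculus of values below for both.\<close>

locale specialization =
  fixes \<kappa> :: "complex \<Rightarrow> 'b :: field" and \<sigma> :: "indet \<Rightarrow> 'b"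
  assumes kappa_add: "\<kappa> (a + b) = \<kappa> a + \<kappa> b"
    and kappa_mult: "\<kappa> (a * b) = \<kappa> a * \<kappa> b"
    and kappa_one: "\<kappa> 1 = 1"
begin

definition spec :: "mpoly \<Rightarrow> 'b" where
  "spec f = (\<Sum>m\<in>Poly_Mapping.keys f. \<kappa> (Poly_Mapping.lookup f m) *
     (\<Prod>v\<in>Poly_Mapping.keys m. \<sigma> v ^ Poly_Mapping.lookup m v))"

lemma kappa_zero: "\<kappa> 0 = 0"
  using kappa_add[of 0 0] by (metis add_cancel_right_right)

lemma spec_add: "spec (f + g) = spec f + spec g"
  unfolding spec_def
  by (rule setsum_keys_plus_distrib) (simp_all add: kappa_zero kappa_add distrib_right)

lemma spec_zero: "spec 0 = 0"
  by (simp add: spec_def)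

lemma spec_single:
  "spec (Poly_Mapping.single m c) = \<kappa> c * (\<Prod>v\<in>UNIV. \<sigma> v ^ Poly_Mapping.lookup m v)"
proof -
  have "(\<Prod>v\<in>Poly_Mapping.keys m. \<sigma> v ^ Poly_Mapping.lookup m v)
      = (\<Prod>v\<in>UNIV. \<sigma> v ^ Poly_Mapping.lookup m v)"
    by (rule prod.mono_neutral_left) (auto simp: finite_UNIV_indet in_keys_iff)
  then show ?thesis by (simp add: spec_def kappa_zero)
qed

lemma spec_sum: "spec (\<Sum>i\<in>A. h i) = (\<Sum>i\<in>A. spec (h i))"
  by (induction A rule: infinite_finite_induct) (auto simp: spec_add spec_zero)

lemma spec_mult: "spec (f * g) = spec f * spec g"
proof -
  let ?M = "\<lambda>f m. Poly_Mapping.single m (Poly_Mapping.lookup f m) :: mpoly"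
  have mono: "spec (Poly_Mapping.single m a * Poly_Mapping.single n b)
      = spec (Poly_Mapping.single m a) * spec (Poly_Mapping.single n b)" for m n a b
    by (simp add: mult_single spec_single kappa_mult lookup_add power_add prod.distrib)
  have "spec (f * g) = spec ((\<Sum>m\<in>Poly_Mapping.keys f. ?M f m) * (\<Sum>n\<in>Poly_Mapping.keys g. ?M g n))"
    by (simp only: poly_mapping_sum_single[symmetric])
  also have "\<dots> = spec (\<Sum>m\<in>Poly_Mapping.keys f. ?M f m) * spec (\<Sum>n\<in>Poly_Mapping.keys g. ?M g n)"
    by (simp only: sum_product spec_sum mono)
  finally show ?thesis by (simp only: poly_mapping_sum_single[symmetric])
qed

lemma spec_const: "spec (pconst c) = \<kappa> c"
  by (simp add: pconst_def spec_single)

lemma spec_one: "spec 1 = 1"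
  using spec_const[of 1] by (simp add: pconst_def kappa_one)

lemma spec_var: "spec (pvar v) = \<sigma> v"
  by (simp add: pvar_def spec_def kappa_one)

lemma spec_uminus: "spec (- f) = - spec f"
  using spec_add[of f "- f"] by (simp add: spec_zero eq_neg_iff_add_eq_0 add.commute)

text \<open>The partial extension of \<open>spec\<close> to fractions. It is a relation because \<open>spec\<close> may send nonzero
denominators to \<open>0\<close>; a fraction has a value as soon as one of its representations has an
admissible denominator.\<close>

definition val :: "ratfun \<Rightarrow> 'b \<Rightarrow> bool" where
  "val r s \<longleftrightarrow> (\<exists>f g. r = Fract f g \<and> spec g \<noteq> 0 \<and> s = spec f / spec g)"

lemma val_unique:
  assumes "val r s" "val r s'"
  shows "s = s'"
proof -
  obtain f g f' g' where *: "r = Fract f g" "spec g \<noteq> 0" "s = spec f / spec g"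
    "r = Fract f' g'" "spec g' \<noteq> 0" "s' = spec f' / spec g'"
    using assms unfolding val_def by blast
  then have "g \<noteq> 0" "g' \<noteq> 0" by (auto simp: spec_zero)
  with * have "f * g' = f' * g" by (metis eq_fract(1))
  then have "spec f * spec g' = spec f' * spec g" by (metis spec_mult)
  with * show ?thesis by (simp add: frac_eq_eq)
qed

lemma val_of_poly: "val (Fract f 1) (spec f)"
  unfolding val_def by (intro exI[of _ f] exI[of _ 1]) (simp add: spec_one)

lemma val_const: "val (rconst c) (\<kappa> c)"
  using val_of_poly[of "pconst c"] by (simp add: rconst_def spec_const pconst_def[symmetric])

lemma val_var: "val (rvar v) (\<sigma> v)"
  using val_of_poly[of "pvar v"] unfolding rvar_def spec_var unfolding pvar_def .

lemma val_one: "val 1 1"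
  using val_of_poly[of 1] by (simp add: spec_one One_fract_def)

lemma val_zero: "val 0 0"
  using val_of_poly[of 0] by (simp add: spec_zero Zero_fract_def)

lemma val_add: "val r s \<Longrightarrow> val r' s' \<Longrightarrow> val (r + r') (s + s')"
proof -
  assume "val r s" "val r' s'"
  then obtain f g f' g' where *: "r = Fract f g" "spec g \<noteq> 0" "s = spec f / spec g"
    "r' = Fract f' g'" "spec g' \<noteq> 0" "s' = spec f' / spec g'"
    unfolding val_def by blast
  then have "g \<noteq> 0" "g' \<noteq> 0" by (auto simp: spec_zero)
  with * show ?thesis unfolding val_def
    by (intro exI[of _ "f * g' + f' * g"] exI[of _ "g * g'"]) (simp add: spec_add spec_mult add_frac_eq)
qed

lemma val_mult: "val r s \<Longrightarrow> val r' s' \<Longrightarrow> val (r * r') (s * s')"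
proof -
  assume "val r s" "val r' s'"
  then obtain f g f' g' where *: "r = Fract f g" "spec g \<noteq> 0" "s = spec f / spec g"
    "r' = Fract f' g'" "spec g' \<noteq> 0" "s' = spec f' / spec g'"
    unfolding val_def by blast
  then show ?thesis unfolding val_def
    by (intro exI[of _ "f * f'"] exI[of _ "g * g'"]) (simp add: spec_mult)
qed

lemma val_uminus: "val r s \<Longrightarrow> val (- r) (- s)"
proof -
  assume "val r s"
  then obtain f g where *: "r = Fract f g" "spec g \<noteq> 0" "s = spec f / spec g"
    unfolding val_def by blast
  then show ?thesis unfolding val_def
    by (intro exI[of _ "- f"] exI[of _ "g"]) (simp add: spec_uminus)
qed

lemma val_inverse: "val r s \<Longrightarrow> s \<noteq> 0 \<Longrightarrow> val (inverse r) (inverse s)"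
proof -
  assume "val r s" "s \<noteq> 0"
  then obtain f g where *: "r = Fract f g" "spec g \<noteq> 0" "s = spec f / spec g"
    unfolding val_def by blast
  with \<open>s \<noteq> 0\<close> show ?thesis unfolding val_def
    by (intro exI[of _ g] exI[of _ f]) auto
qed

lemma val_diff: "val r s \<Longrightarrow> val r' s' \<Longrightarrow> val (r - r') (s - s')"
  using val_add[of r s "- r'" "- s'"] val_uminus[of r' s'] by simp

lemma val_divide: "val r s \<Longrightarrow> val r' s' \<Longrightarrow> s' \<noteq> 0 \<Longrightarrow> val (r / r') (s / s')"
  using val_mult[of r s "inverse r'" "inverse s'"] val_inverse[of r' s']
  by (simp add: field_class.field_divide_inverse)

lemma val_two: "val 2 2"
  using val_add[OF val_one val_one] by simp

lemma val_nonzero: "val r s \<Longrightarrow> s \<noteq> 0 \<Longrightarrow> r \<noteq> 0"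
  using val_unique[OF _ val_zero] by blast

lemma val_eqI: "val r s \<Longrightarrow> s = s' \<Longrightarrow> val r s'"
  by simp

lemma val_coordinates:
  "val xx (\<sigma> X)" "val yy (\<sigma> Y)" "val zz (\<sigma> Z)" "val ww (\<sigma> W)" "val qq (\<sigma> Q)" "val pp (\<sigma> P)"
  "val tt (\<sigma> T)" "val (alpha 1) (\<sigma> A1)" "val (alpha 2) (\<sigma> A2)" "val (alpha 3) (\<sigma> A3)"
  "val (alpha 4) (\<sigma> A4)" "val (alpha 5) (\<sigma> A5)" "val (alpha 6) (\<sigma> A6)"
  unfolding rvar_conv[symmetric] by (rule val_var)+

lemmas val_arith = val_one val_two val_add val_diff val_uminus val_mult val_divide

end

interpretation const: specialization rconst \<sigma> for \<sigma>
  by standard (simp_all add: rconst_def One_fract_def single_add mult_single)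

interpretation point: specialization "\<lambda>c. c" e for e :: "indet \<Rightarrow> complex"
  by standard simp_all

lemma mpoly_eval_eq: "mpoly_eval e = point.spec e"
  by (simp add: fun_eq_iff mpoly_eval_def point.spec_def)

lemma has_value_eq: "has_value r e c = point.val e r c"
  by (simp add: has_value_def point.val_def mpoly_eval_eq)

section \<open>Substitution automorphisms\<close>

text \<open>Tuples are indexed like \<open>coords\<close>. Entry 7 is the image of \<open>alpha 0\<close>, which is not an indeterminate;
hence the shift by one for the remaining parameters.\<close>

definition image_of :: "ratfun list \<Rightarrow> indet \<Rightarrow> ratfun" where
  "image_of l v = l ! (if indet_index v \<le> 6 then indet_index v else Suc (indet_index v))"

text \<open>The image of \<open>alpha 0\<close> is forced by those of \<open>alpha 1, \<dots>, alpha 6\<close>.\<close>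

definition balanced :: "ratfun list \<Rightarrow> bool" where
  "balanced l \<longleftrightarrow> length l = 14 \<and>
     l ! 7 = 1 - l ! 8 - 2 * l ! 9 - 2 * l ! 10 - 2 * l ! 11 - l ! 12 - l ! 13"

text \<open>Applying the substitution to its own tuple is defined and gives back the coordinates. The condition
speaks of partial values only, so it can be checked before the substitution is known to
extend to the whole field.\<close>

definition involutive :: "ratfun list \<Rightarrow> bool" where
  "involutive l \<longleftrightarrow> balanced l \<and> list_all2 (const.val (image_of l)) l coords"

definition subst :: "ratfun list \<Rightarrow> ratfun \<Rightarrow> ratfun" where
  "subst l r = (THE s. const.val (image_of l) r s)"

lemma Fract_pconst: "Fract (pconst c) 1 = rconst c"
  by (simp add: pconst_def rconst_def)

lemma Fract_pvar: "Fract (pvar v) 1 = rvar v"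
  unfolding pvar_def rvar_def ..

lemma rvar_coords: "rvar v = coords ! (if indet_index v \<le> 6 then indet_index v else Suc (indet_index v))"
  by (cases v) (simp_all add: coords_def rvar_conv flip: One_nat_def)

lemma list_all2_coords:
  assumes "length l = 14"
  shows "list_all2 R coords l \<longleftrightarrow> R xx (l ! 0) \<and> R yy (l ! 1) \<and> R zz (l ! 2) \<and> R ww (l ! 3)
     \<and> R qq (l ! 4) \<and> R pp (l ! 5) \<and> R tt (l ! 6) \<and> R (alpha 0) (l ! 7) \<and> R (alpha 1) (l ! 8) \<and> R (alpha 2) (l ! 9) \<and> R (alpha 3) (l ! 10)
     \<and> R (alpha 4) (l ! 11) \<and> R (alpha 5) (l ! 12) \<and> R (alpha 6) (l ! 13)"
proof -
  have "length l = length coords" using assms by (simp add: coords_def)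
  then obtain a b c d e f g h i j k m n p where "l = [a,b,c,d,e,f,g,h,i,j,k,m,n,p]"
    unfolding coords_def by (auto simp: length_Suc_conv)
  then show ?thesis by (simp add: coords_def)
qed

lemma val_coords:
  assumes "balanced l"
  shows "list_all2 (const.val (image_of l)) coords l" (is "list_all2 ?V _ _")
proof -
  have 1: "length l = 14" using assms by (simp add: balanced_def)
  have "?V (alpha 0) (1 - l ! 8 - 2 * l ! 9 - 2 * l ! 10 - 2 * l ! 11 - l ! 12 - l ! 13)"
    unfolding alpha_0_eq using const.val_coordinates[of "image_of l"]
    by (intro const.val_arith) (simp_all add: image_of_def)
  then have "?V (alpha 0) (l ! 7)" using assms by (simp add: balanced_def)
  then show ?thesis unfolding list_all2_coords[OF 1] using const.val_coordinates[of "image_of l"]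
    by (simp add: image_of_def)
qed

context
  fixes l assumes inv: "involutive l"
begin

abbreviation (input) "Val \<equiv> const.val (image_of l)"
abbreviation (input) "Spec \<equiv> const.spec (image_of l)"

lemma balanced_involutive: "balanced l"
  using inv by (simp add: involutive_def)

text \<open>Substituting a second time undoes the first substitution. For indeterminates this is the
assumption, and values respect sums and products.\<close>

lemma val_spec: "Val (Spec f) (Fract f 1)"
proof (induction f rule: mpoly_induct)
  case (const c)
  show ?case by (simp only: const.spec_const Fract_pconst const.val_const)
next
  case (var v)
  have "Val (image_of l v) (rvar v)"
    using inv unfolding involutive_def image_of_def rvar_coords
    by (cases v) (auto simp: list_all2_conv_all_nth balanced_def)
  then show ?case by (simp only: const.spec_var Fract_pvar)
next
  case (add f g)
  then show ?case using const.val_add[OF add] by (simp add: const.spec_add)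
next
  case (mult f g)
  then show ?case using const.val_mult[OF mult] by (simp add: const.spec_mult)
qed

text \<open>If \<open>f\<close> were sent to \<open>0\<close>, the second substitution, which recovers \<open>f\<close>, would have to start from \<open>0\<close>.\<close>

lemma spec_eq_0: "Spec f = 0 \<Longrightarrow> f = 0"
proof -
  assume "Spec f = 0"
  then have "Fract f 1 = 0" using val_spec[of f] const.val_unique const.val_zero by metis
  then show ?thesis by (simp add: Zero_fract_def eq_fract)
qed

lemma val_total: "\<exists>s. Val r s"
proof -
  obtain f g where "r = Fract f g" "g \<noteq> 0" by (cases r rule: Fract_cases)
  then show ?thesis unfolding const.val_def using spec_eq_0 by blast
qed

lemma val_subst: "Val r (subst l r)"
  unfolding subst_def by (rule theI') (metis val_total const.val_unique)

lemma subst_eqI: "Val r s \<Longrightarrow> subst l r = s"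
  using val_subst const.val_unique by blast

lemma val_sym:
  assumes "Val r s"
  shows "Val s r"
proof -
  obtain f g where *: "r = Fract f g" "Spec g \<noteq> 0" "s = Spec f / Spec g"
    using assms unfolding const.val_def by blast
  then have g: "g \<noteq> 0" by (auto simp: const.spec_zero)
  then have "Fract g 1 \<noteq> 0" by (simp add: Zero_fract_def eq_fract)
  then have "Val s (Fract f 1 / Fract g 1)"
    unfolding * by (intro const.val_divide val_spec)
  then show ?thesis using * by simp
qed

lemma subst_subst: "subst l (subst l r) = r"
  by (rule subst_eqI[OF val_sym[OF val_subst]])

lemma field_aut_subst: "field_aut (subst l)"
  unfolding field_aut_def
proof (intro conjI allI)
  show "bij (subst l)" by (rule o_bij[of "subst l"]) (simp_all add: fun_eq_iff subst_subst)
next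
  show "subst l (f + g) = subst l f + subst l g" for f g
    by (rule subst_eqI[OF const.val_add[OF val_subst val_subst]])
  show "subst l (f * g) = subst l f * subst l g" for f g
    by (rule subst_eqI[OF const.val_mult[OF val_subst val_subst]])
  show "subst l (rconst c) = rconst c" for c
    by (rule subst_eqI[OF const.val_const])
qed

lemma map_subst_coords: "map (subst l) coords = l"
proof -
  have "list_all2 (\<lambda>r s. subst l r = s) coords l"
    using val_coords[OF balanced_involutive] by (rule list_all2_mono) (rule subst_eqI)
  then show ?thesis by (simp add: list_all2_conv_all_nth list_eq_iff_nth_eq)
qed

end

lemma field_aut_ext:
  assumes \<phi>: "field_aut \<phi>" and \<psi>: "field_aut \<psi>" and eq: "map \<phi> coords = map \<psi> coords"
  shows "\<phi> = \<psi>"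
proof
  fix r :: ratfun
  note hom = \<phi>[unfolded field_aut_def] \<psi>[unfolded field_aut_def]
  have var: "\<phi> (rvar v) = \<psi> (rvar v)" for v
    using eq by (cases v) (simp_all add: coords_def rvar_conv)
  have add: "\<phi> (a + b) = \<phi> a + \<phi> b" "\<psi> (a + b) = \<psi> a + \<psi> b" for a b
    using hom by auto
  have mult: "\<phi> (a * b) = \<phi> a * \<phi> b" "\<psi> (a * b) = \<psi> a * \<psi> b" for a b
    using hom by auto
  have poly: "\<phi> (Fract f 1) = \<psi> (Fract f 1)" for f
  proof (induction f rule: mpoly_induct)
    case (const c)
    show ?case using hom by (simp add: Fract_pconst)
  next
    case (var v)
    show ?case by (simp only: Fract_pvar \<open>\<And>v. \<phi> (rvar v) = \<psi> (rvar v)\<close>)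
  next
    case (add f g)
    have "Fract (f + g) 1 = Fract f 1 + Fract g 1" by simp
    then show ?case using add hom by metis
  next
    case (mult f g)
    have "Fract (f * g) 1 = Fract f 1 * Fract g 1" by simp
    then show ?case using mult hom by metis
  qed
  obtain f g where r: "r = Fract f g" "g \<noteq> 0" by (cases r rule: Fract_cases)
  have inj: "\<psi> a = \<psi> b \<Longrightarrow> a = b" for a b
    using \<psi> by (auto simp: field_aut_def bij_def inj_def)
  have "\<psi> 0 = 0" using add(2)[of 0 0] by (metis add_cancel_right_right add_0)
  then have nz: "\<psi> (Fract g 1) \<noteq> 0"
    using inj[of "Fract g 1" 0] r by (auto simp: Zero_fract_def eq_fract)
  have rg: "r * Fract g 1 = Fract f 1" using r by (simp add: eq_fract)
  have "\<phi> r * \<psi> (Fract g 1) = \<phi> (Fract f 1)" by (simp add: poly[symmetric] mult[symmetric] rg)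
  also have "\<dots> = \<psi> r * \<psi> (Fract g 1)" by (simp add: poly mult[symmetric] rg)
  finally show "\<phi> r = \<psi> r" using nz by simp
qed

lemma field_aut_comp: "field_aut \<phi> \<Longrightarrow> field_aut \<psi> \<Longrightarrow> field_aut (\<phi> \<circ> \<psi>)"
  by (auto simp: field_aut_def intro: bij_comp)

lemma field_aut_arith:
  assumes "field_aut \<phi>"
  shows "\<phi> (f + g) = \<phi> f + \<phi> g" "\<phi> (f * g) = \<phi> f * \<phi> g" "\<phi> (- f) = - \<phi> f"
    "\<phi> (f - g) = \<phi> f - \<phi> g" "\<phi> (f / g) = \<phi> f / \<phi> g" "\<phi> 1 = 1" "\<phi> f = 0 \<longleftrightarrow> f = 0"
proof -
  show add: "\<phi> (f + g) = \<phi> f + \<phi> g" and mult: "\<phi> (f * g) = \<phi> f * \<phi> g" for f g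
    using assms by (auto simp: field_aut_def)
  have inj: "\<phi> a = \<phi> b \<Longrightarrow> a = b" for a b
    using assms by (auto simp: field_aut_def bij_def inj_def)
  show one: "\<phi> 1 = 1" using assms unfolding field_aut_def by (metis rconst_def One_fract_def single_one)
  have zero: "\<phi> 0 = 0" using add[of 0 0] by (metis add_cancel_right_right add_0)
  show eq0: "\<phi> f = 0 \<longleftrightarrow> f = 0" for f using inj[of f 0] zero by auto
  show minus: "\<phi> (- f) = - \<phi> f" for f
    using add[of f "- f"] by (simp add: zero eq_neg_iff_add_eq_0 add.commute)
  show "\<phi> (f - g) = \<phi> f - \<phi> g" using add[of f "- g"] by (simp add: minus)
  show "\<phi> (f / g) = \<phi> f / \<phi> g"
  proof (cases "g = 0")
    case False
    then have "\<phi> (f / g) * \<phi> g = \<phi> f" by (simp add: mult[symmetric])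
    then show ?thesis using False eq0 by (simp add: eq_divide_eq)
  qed (simp add: zero)
qed

section \<open>The generators\<close>

text \<open>Rows 0 to 6 are \<open>s\<^sub>0, \<dots>, s\<^sub>6\<close> and rows 7 to 10 are \<open>\<pi>\<^sub>1, \<dots>, \<pi>\<^sub>4\<close>. The field is left open because the
same formulas are used for the coordinate functions, where they define the generators, and for
complex numbers, where they give the values of the transformed functions along a solution.\<close>

definition images ::
  "'b::field \<Rightarrow> 'b \<Rightarrow> 'b \<Rightarrow> 'b \<Rightarrow> 'b \<Rightarrow> 'b \<Rightarrow> 'b \<Rightarrow> (nat \<Rightarrow> 'b) \<Rightarrow> 'b list list" where
  "images x y z w q p t a =
   [[x + a 0 / (y - 1), y, z, w, q, p, t, - a 0, a 1, a 2 + a 0, a 3, a 4, a 5, a 6],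
    [x + a 1 / y, y, z, w, q, p, t, a 0, - a 1, a 2 + a 1, a 3, a 4, a 5, a 6],
    [x, y - a 2 / (x - z), z, w + a 2 / (x - z), q, p, t,
      a 0 + a 2, a 1 + a 2, - a 2, a 3 + a 2, a 4, a 5, a 6],
    [x, y, z + a 3 / w, w, q, p, t, a 0, a 1, a 2 + a 3, - a 3, a 4 + a 3, a 5, a 6],
    [x, y, z, w - a 4 * q / (z * q - 1), q, p - a 4 * z / (z * q - 1), t,
      a 0, a 1, a 2, a 3 + a 4, - a 4, a 5 + a 4, a 6 + a 4],
    [x, y, z, w, q + a 5 / p, p, t, a 0, a 1, a 2, a 3, a 4 + a 5, - a 5, a 6],
    [x, y, z, w, q + a 6 / (p - t), p, t, a 0, a 1, a 2, a 3, a 4 + a 6, a 5, - a 6],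
    [- x, 1 - y, - z, - w, - q, t - p, t, a 1, a 0, a 2, a 3, a 4, a 6, a 5],
    [t * q, p / t, t / z, - ((z * w + a 3) * z / t), x / t, t * y, t,
      a 6, a 5, a 4, a 3, a 2, a 1, a 0],
    [x, y, z, w, q, p - t, - t, a 0, a 1, a 2, a 3, a 4, a 6, a 5],
    [- x, 1 - y, - z, - w, - q, - p, - t, a 1, a 0, a 2, a 3, a 4, a 5, a 6]]"

definition gen_images :: "ratfun list list" where
  "gen_images = images xx yy zz ww qq pp tt alpha"

lemmas gen_images_defs = gen_images_def images_def

definition gen :: "nat \<Rightarrow> ratfun \<Rightarrow> ratfun" where
  "gen k = subst (gen_images ! k)"

text \<open>The coordinates are \<open>3, 4, \<dots>, 15\<close>, in the order of the indeterminates. A rational function is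
nonzero if it has a nonzero value at this point, which is the case for all denominators that occur.\<close>

definition test_point :: "indet \<Rightarrow> complex" where
  "test_point v = of_nat (indet_index v + 3)"

lemma nonzero:
  "yy \<noteq> 0" "yy - 1 \<noteq> 0" "xx - zz \<noteq> 0" "ww \<noteq> 0" "zz \<noteq> 0" "zz * qq - 1 \<noteq> 0"
  "zz * ww + alpha 3 \<noteq> 0" "pp \<noteq> 0" "pp - tt \<noteq> 0" "tt \<noteq> 0"
  by (rule point.val_nonzero[of test_point], (rule point.val_arith point.val_coordinates)+,
      simp add: test_point_def)+

text \<open>The same facts in the shapes, and with the factors in the orders, that the simplifier meets.\<close>

lemma nonzero':
  "yy \<noteq> 1" "xx \<noteq> zz" "zz \<noteq> xx" "zz * qq \<noteq> 1" "qq * zz \<noteq> 1" "ww * zz + alpha 3 \<noteq> 0"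
  "pp \<noteq> tt" "tt \<noteq> pp" "yy \<noteq> 0" "ww \<noteq> 0" "zz \<noteq> 0" "pp \<noteq> 0" "tt \<noteq> 0"
  using nonzero by (auto simp: mult.commute)

lemma less_11_cases:
  assumes "k < (11::nat)"
  obtains "k = 0" | "k = 1" | "k = 2" | "k = 3" | "k = 4" | "k = 5"
    | "k = 6" | "k = 7" | "k = 8" | "k = 9" | "k = 10"
proof -
  have "k = 0 \<or> k = 1 \<or> k = 2 \<or> k = 3 \<or> k = 4 \<or> k = 5
      \<or> k = 6 \<or> k = 7 \<or> k = 8 \<or> k = 9 \<or> k = 10"
    using assms by presburger
  then show ?thesis using that by blast
qed

lemma balanced_gen: "k < 11 \<Longrightarrow> balanced (gen_images ! k)"
  by (erule less_11_cases; simp add: gen_images_defs balanced_def alpha_0_eq)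

lemma involutive_gen:
  assumes "k < 11"
  shows "involutive (gen_images ! k)"
proof -
  (* obtained rather than defined, so that V stays an opaque relation when k is instantiated *)
  obtain V where V_def: "V = const.val (image_of (gen_images ! k))" by blast
  note arith = const.val_arith[of "image_of (gen_images ! k)", folded V_def]
  note eqI = const.val_eqI[of "image_of (gen_images ! k)", folded V_def]
  note bal = balanced_gen[OF assms]
  have vals: "list_all2 V coords (gen_images ! k)" unfolding V_def by (rule val_coords[OF bal])
  have "list_all2 V (gen_images ! k) coords"
    using assms vals
    by (elim less_11_cases; hypsubst)
       (simp_all add: gen_images_defs coords_def,
        (elim conjE; intro conjI; rule eqI, ((rule arith | assumption)+)?;
          simp add: divide_simps nonzero nonzero'; (simp add: algebra_simps)?)+)
  then show ?thesis using bal V_def by (simp add: involutive_def)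
qed

lemma field_aut_gen: "k < 11 \<Longrightarrow> field_aut (gen k)"
  unfolding gen_def by (intro field_aut_subst involutive_gen)

lemma gen_gen: "k < 11 \<Longrightarrow> gen k \<circ> gen k = id"
  by (simp add: gen_def fun_eq_iff subst_subst involutive_gen)

lemma map_gen_coords: "k < 11 \<Longrightarrow> map (gen k) coords = gen_images ! k"
  unfolding gen_def by (intro map_subst_coords involutive_gen)

lemmas gen_coords = map_gen_coords[of 0] map_gen_coords[of 1] map_gen_coords[of 2] map_gen_coords[of 3]
  map_gen_coords[of 4] map_gen_coords[of 5] map_gen_coords[of 6] map_gen_coords[of 7]
  map_gen_coords[of 8] map_gen_coords[of 9] map_gen_coords[of 10]

lemmas gen_simps = gen_coords[unfolded coords_def gen_images_defs, simplified]
  field_aut_arith[OF field_aut_gen]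

section \<open>Commutation, conjugation and braid relations\<close>

lemma gen_comp_eqI:
  assumes "i < 11" "j < 11" "k < 11" "l < 11"
    and "map (gen i) (gen_images ! j) = map (gen k) (gen_images ! l)"
  shows "gen i \<circ> gen j = gen k \<circ> gen l"
proof (rule field_aut_ext)
  show "map (gen i \<circ> gen j) coords = map (gen k \<circ> gen l) coords"
    using assms by (simp flip: map_map add: map_gen_coords)
qed (use assms in \<open>auto intro!: field_aut_comp field_aut_gen\<close>)

lemma gen_braidI:
  assumes "i < 11" "j < 11"
    and "map (gen i) (map (gen j) (gen_images ! i)) = map (gen j) (map (gen i) (gen_images ! j))"
  shows "gen i \<circ> gen j \<circ> gen i = gen j \<circ> gen i \<circ> gen j"
proof (rule field_aut_ext)
  show "map (gen i \<circ> gen j \<circ> gen i) coords = map (gen j \<circ> gen i \<circ> gen j) coords"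
    using assms by (simp flip: map_map add: map_gen_coords)
qed (use assms in \<open>auto intro!: field_aut_comp field_aut_gen\<close>)

lemma gen_commute:
  "gen 0 \<circ> gen 1 = gen 1 \<circ> gen 0"
  "gen 0 \<circ> gen 3 = gen 3 \<circ> gen 0"
  "gen 0 \<circ> gen 4 = gen 4 \<circ> gen 0"
  "gen 0 \<circ> gen 5 = gen 5 \<circ> gen 0"
  "gen 0 \<circ> gen 6 = gen 6 \<circ> gen 0"
  "gen 1 \<circ> gen 3 = gen 3 \<circ> gen 1"
  "gen 1 \<circ> gen 4 = gen 4 \<circ> gen 1"
  "gen 1 \<circ> gen 5 = gen 5 \<circ> gen 1"
  "gen 1 \<circ> gen 6 = gen 6 \<circ> gen 1"
  "gen 2 \<circ> gen 4 = gen 4 \<circ> gen 2"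
  "gen 2 \<circ> gen 5 = gen 5 \<circ> gen 2"
  "gen 2 \<circ> gen 6 = gen 6 \<circ> gen 2"
  "gen 3 \<circ> gen 5 = gen 5 \<circ> gen 3"
  "gen 3 \<circ> gen 6 = gen 6 \<circ> gen 3"
  "gen 5 \<circ> gen 6 = gen 6 \<circ> gen 5"
  by (rule gen_comp_eqI; simp add: gen_images_defs gen_simps)+

lemma gen_conj:
  assumes "j \<in> {1..4}" "i \<le> 6"
  shows "gen (j + 6) \<circ> gen i = gen (diagram_perm j i) \<circ> gen (j + 6)"
proof (rule gen_comp_eqI)
  have j: "j = 1 \<or> j = 2 \<or> j = 3 \<or> j = 4" using assms by auto
  have i: "i = 0 \<or> i = 1 \<or> i = 2 \<or> i = 3 \<or> i = 4 \<or> i = 5 \<or> i = 6" using assms by presburger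
  show "j + 6 < 11" "i < 11" "j + 6 < 11" "diagram_perm j i < 11"
    using assms by (auto simp: diagram_perm_def)
  show "map (gen (j + 6)) (gen_images ! i) = map (gen (diagram_perm j i)) (gen_images ! (j + 6))"
    using j i
    by (elim disjE; hypsubst; simp add: gen_images_defs gen_simps diagram_perm_def nonzero')
       (simp_all add: divide_simps nonzero nonzero', simp_all add: algebra_simps)
qed

text \<open>Along an edge of the diagram one reflection, with parameter \<open>a\<close>, adds \<open>a / u\<close> to a variable \<open>q\<close>, and
the other, with parameter \<open>b\<close>, subtracts \<open>b z / D\<close> from \<open>u\<close>, where \<open>D\<close> depends on \<open>q\<close> with
slope \<open>z\<close>. So \<open>u D\<close> becomes \<open>N = u D + z a\<close> under the first and \<open>M = u D - b z\<close> under the second,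
and every denominator met in the braid relation is a quotient of products of \<open>u, D, M, N\<close>.
The second and third identities are the braid relation evaluated at \<open>q\<close> and at \<open>u\<close>. The first is
the relation at a further variable that the second reflection moves by \<open>b q / D\<close>, as \<open>s\<^sub>4\<close> does.\<close>

lemma braid_identities:
  fixes a b u z q D c :: "'a :: field"
  assumes u: "u \<noteq> 0" and D: "D \<noteq> 0" and N1: "u * D - b * z \<noteq> 0" and N2: "u * D + z * a \<noteq> 0"
  defines "c \<equiv> (a + b) / (u - b * z / D)"
  shows "b * q / D + a * (q + c) / (D + z * c) = (a + b) * (q + a / u) / (D + z * (a / u))"
    and "c = a / u + b / (u - (a + b) * z / (D + z * (a / u)))"
    and "b * z / D + a * z / (D + z * c) = (a + b) * z / (D + z * (a / u))"
proof -
  define M where "M = u * D - b * z"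
  define N where "N = u * D + z * a"
  have nz: "M \<noteq> 0" "N \<noteq> 0" using N1 N2 by (simp_all add: M_def N_def)
  have c: "c = (a + b) * D / M"
    unfolding c_def using D nz(1) by (simp add: M_def divide_simps)
  have Nu: "D + z * (a / u) = N / u" using u by (simp add: N_def field_simps)
  have "D + z * c = D * (M + z * (a + b)) / M" using nz unfolding c by (simp add: field_simps)
  then have DN: "D + z * c = D * N / M" by (simp add: M_def N_def algebra_simps)
  have "u - (a + b) * z / (N / u) = u * (N - (a + b) * z) / N" using nz u by (simp add: field_simps)
  then have uM: "u - (a + b) * z / (N / u) = u * M / N" by (simp add: M_def N_def algebra_simps)
  show "b * q / D + a * (q + c) / (D + z * c) = (a + b) * (q + a / u) / (D + z * (a / u))"
    unfolding DN Nu unfolding c using D nz u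
    by (simp add: divide_simps) (simp add: M_def N_def algebra_simps)
  show "c = a / u + b / (u - (a + b) * z / (D + z * (a / u)))"
    unfolding Nu uM unfolding c using D nz u
    by (simp add: divide_simps) (simp add: M_def N_def algebra_simps)
  show "b * z / D + a * z / (D + z * c) = (a + b) * z / (D + z * (a / u))"
    unfolding DN Nu using D nz u
    by (simp add: divide_simps) (simp add: M_def N_def algebra_simps)
qed

text \<open>The hypotheses \<open>M \<noteq> 0\<close> and \<open>N \<noteq> 0\<close> of \<open>braid_identities\<close> for the six edges; where the slope \<open>z\<close> is
\<open>1\<close>, that factor is kept so that the facts match.\<close>

lemma nonzero_braid:
  "(yy - 1) * (xx - zz) - alpha 2 * 1 \<noteq> 0"
  "(yy - 1) * (xx - zz) + 1 * alpha 0 \<noteq> 0"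
  "yy * (xx - zz) - alpha 2 * 1 \<noteq> 0"
  "yy * (xx - zz) + 1 * alpha 1 \<noteq> 0"
  "(xx - zz) * ww - alpha 3 * 1 \<noteq> 0"
  "(xx - zz) * ww + 1 * alpha 2 \<noteq> 0"
  "ww * (zz * qq - 1) - alpha 4 * qq \<noteq> 0"
  "ww * (zz * qq - 1) + qq * alpha 3 \<noteq> 0"
  "pp * (zz * qq - 1) - alpha 4 * zz \<noteq> 0"
  "pp * (zz * qq - 1) + zz * alpha 5 \<noteq> 0"
  "(pp - tt) * (zz * qq - 1) - alpha 4 * zz \<noteq> 0"
  "(pp - tt) * (zz * qq - 1) + zz * alpha 6 \<noteq> 0"
  unfolding alpha_0_eq
  by (rule point.val_nonzero[of test_point], (rule point.val_arith point.val_coordinates)+,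
      simp add: test_point_def)+

text \<open>In each of the following proofs, \<open>shape\<close> brings the denominators after a shift into the form
\<open>u - c\<close> or \<open>D + z c\<close> of \<open>braid_identities\<close>.\<close>

lemma braid_0_2: "gen 0 \<circ> gen 2 \<circ> gen 0 = gen 2 \<circ> gen 0 \<circ> gen 2"
proof (rule gen_braidI)
  have shape: "yy - c - 1 = (yy - 1) - c" "xx + c - zz = (xx - zz) + c"
      "alpha 2 + alpha 0 = alpha 0 + alpha 2" for c
    by (simp_all add: algebra_simps)
  have neg_sum: "- c - d = - (c + d)" for c d :: ratfun by simp
  note nz = nonzero(2) nonzero(3) nonzero_braid(1) nonzero_braid(2)
  note eqs = braid_identities(2,3)[of "yy - 1" "xx - zz" "alpha 2" 1 "alpha 0", OF nz,
      unfolded mult_1_left mult_1_right One_nat_def]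
  show "map (gen 0) (map (gen 2) (gen_images ! 0)) = map (gen 2) (map (gen 0) (gen_images ! 2))"
    by (simp add: gen_images_defs gen_simps, simp only: shape neg_sum neg_equal_iff_equal)
       (intro conjI; rule eqs eqs[symmetric])
qed simp_all

lemma braid_1_2: "gen 1 \<circ> gen 2 \<circ> gen 1 = gen 2 \<circ> gen 1 \<circ> gen 2"
proof (rule gen_braidI)
  have shape: "xx + c - zz = (xx - zz) + c"
      "alpha 2 + alpha (Suc 0) = alpha (Suc 0) + alpha 2" for c
    by (simp_all add: algebra_simps)
  have neg_sum: "- c - d = - (c + d)" for c d :: ratfun by simp
  note nz = nonzero(1) nonzero(3) nonzero_braid(3) nonzero_braid(4)
  note eqs = braid_identities(2,3)[of yy "xx - zz" "alpha 2" 1 "alpha 1", OF nz,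
      unfolded mult_1_left mult_1_right One_nat_def]
  show "map (gen 1) (map (gen 2) (gen_images ! 1)) = map (gen 2) (map (gen 1) (gen_images ! 2))"
    by (simp add: gen_images_defs gen_simps, simp only: shape neg_sum neg_equal_iff_equal)
       (intro conjI; rule eqs eqs[symmetric])
qed simp_all

lemma braid_2_3: "gen 2 \<circ> gen 3 \<circ> gen 2 = gen 3 \<circ> gen 2 \<circ> gen 3"
proof (rule gen_braidI)
  have shape: "xx - (zz + c) = (xx - zz) - c"
      "alpha 3 + alpha 2 = alpha 2 + alpha 3" for c
    by (simp_all add: algebra_simps)
  have neg_sum: "- c - d = - (c + d)" for c d :: ratfun by simp
  note nz = nonzero(3) nonzero(4) nonzero_braid(5) nonzero_braid(6)
  note eqs = braid_identities(2,3)[of "xx - zz" ww "alpha 3" 1 "alpha 2", OF nz,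
      unfolded mult_1_left mult_1_right One_nat_def]
  show "map (gen 2) (map (gen 3) (gen_images ! 2)) = map (gen 3) (map (gen 2) (gen_images ! 3))"
    by (simp add: gen_images_defs gen_simps, simp only: shape neg_sum neg_equal_iff_equal)
       (intro conjI; rule eqs eqs[symmetric])
qed simp_all

lemma braid_3_4: "gen 3 \<circ> gen 4 \<circ> gen 3 = gen 4 \<circ> gen 3 \<circ> gen 4"
proof (rule gen_braidI)
  have shape: "(zz + c) * qq - 1 = (zz * qq - 1) + qq * c"
      "alpha 4 + alpha 3 = alpha 3 + alpha 4" for c
    by (simp_all add: algebra_simps)
  have neg_sum: "- c - d = - (c + d)" for c d :: ratfun by simp
  note nz = nonzero(4) nonzero(6) nonzero_braid(7) nonzero_braid(8)
  note eqs = braid_identities(1)[of ww "zz * qq - 1" "alpha 4" qq "alpha 3" zz, OF nz]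
    braid_identities(2,3)[of ww "zz * qq - 1" "alpha 4" qq "alpha 3", OF nz]
  show "map (gen 3) (map (gen 4) (gen_images ! 3)) = map (gen 4) (map (gen 3) (gen_images ! 4))"
    by (simp add: gen_images_defs gen_simps, simp only: shape neg_sum neg_equal_iff_equal)
       (intro conjI; rule eqs eqs[symmetric])
qed simp_all

lemma braid_4_5: "gen 4 \<circ> gen 5 \<circ> gen 4 = gen 5 \<circ> gen 4 \<circ> gen 5"
proof (rule gen_braidI)
  have shape: "zz * (qq + c) - 1 = (zz * qq - 1) + zz * c"
      "alpha 4 + alpha 5 = alpha 5 + alpha 4" for c
    by (simp_all add: algebra_simps)
  have neg_sum: "- c - d = - (c + d)" for c d :: ratfun by simp
  note nz = nonzero(8) nonzero(6) nonzero_braid(9) nonzero_braid(10)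
  note eqs = braid_identities(1)[of pp "zz * qq - 1" "alpha 4" zz "alpha 5" qq, OF nz]
    braid_identities(2,3)[of pp "zz * qq - 1" "alpha 4" zz "alpha 5", OF nz]
  show "map (gen 4) (map (gen 5) (gen_images ! 4)) = map (gen 5) (map (gen 4) (gen_images ! 5))"
    by (simp add: gen_images_defs gen_simps, simp only: shape neg_sum neg_equal_iff_equal)
       (intro conjI; rule eqs eqs[symmetric])
qed simp_all

lemma braid_4_6: "gen 4 \<circ> gen 6 \<circ> gen 4 = gen 6 \<circ> gen 4 \<circ> gen 6"
proof (rule gen_braidI)
  have shape: "pp - c - tt = (pp - tt) - c" "zz * (qq + c) - 1 = (zz * qq - 1) + zz * c"
      "alpha 4 + alpha 6 = alpha 6 + alpha 4" for c
    by (simp_all add: algebra_simps)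
  have neg_sum: "- c - d = - (c + d)" for c d :: ratfun by simp
  note nz = nonzero(9) nonzero(6) nonzero_braid(11) nonzero_braid(12)
  note eqs = braid_identities(1)[of "pp - tt" "zz * qq - 1" "alpha 4" zz "alpha 6" qq, OF nz]
    braid_identities(2,3)[of "pp - tt" "zz * qq - 1" "alpha 4" zz "alpha 6", OF nz]
  show "map (gen 4) (map (gen 6) (gen_images ! 4)) = map (gen 6) (map (gen 4) (gen_images ! 6))"
    by (simp add: gen_images_defs gen_simps, simp only: shape neg_sum neg_equal_iff_equal)
       (intro conjI; rule eqs eqs[symmetric])
qed simp_all

section \<open>Regularity along a solution\<close>

text \<open>If \<open>d\<close> vanished at \<open>e\<close>, it would vanish on the whole line through \<open>e\<close> in the direction of \<open>v\<close>. Regularity of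
\<open>r\<close> at \<open>e\<close> persists on that line near \<open>e\<close>, so \<open>n = r d\<close> would vanish there too, although it is affine
and not constant.\<close>

lemma regular_imp_denominator_nonzero:
  assumes reg: "point.val e r c" and rd: "r * d = n"
    and d: "\<And>s. point.val (e(v := s)) d \<delta>"
    and n: "\<And>s. point.val (e(v := s)) n (k + m * s)"
    and m: "\<delta> = 0 \<Longrightarrow> m \<noteq> 0"
  shows "\<delta> \<noteq> 0"
proof
  assume \<delta>: "\<delta> = 0"
  obtain f g where r: "r = Fract f g" "point.spec e g \<noteq> 0"
    using reg by (auto simp: point.val_def)
  have "isCont (\<lambda>s. (e(v := s)) u) (e v)" for u
    by (cases "u = v") auto
  then have "isCont (\<lambda>s. point.spec (e(v := s)) g) (e v)"
    unfolding point.spec_def by (intro continuous_intros) auto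
  then have "((\<lambda>s. point.spec (e(v := s)) g) \<longlongrightarrow> point.spec e g) (at (e v))"
    by (simp add: isCont_def)
  then have "\<forall>\<^sub>F s in at (e v). point.spec (e(v := s)) g \<noteq> 0"
    by (rule tendsto_imp_eventually_ne) (rule r(2))
  moreover have "\<forall>\<^sub>F s in at (e v). s \<noteq> - k / m"
    by (rule eventually_neq_at_within)
  ultimately have "\<forall>\<^sub>F s in at (e v). point.spec (e(v := s)) g \<noteq> 0 \<and> s \<noteq> - k / m"
    by eventually_elim simp
  then obtain s where s: "point.spec (e(v := s)) g \<noteq> 0" "s \<noteq> - k / m"
    using eventually_happens trivial_limit_at by blast
  have "point.val (e(v := s)) r (point.spec (e(v := s)) f / point.spec (e(v := s)) g)"
    unfolding point.val_def using s r by blast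
  from point.val_mult[OF this d] have "point.val (e(v := s)) n 0"
    by (simp add: rd \<delta>)
  with n have "k + m * s = 0" using point.val_unique by blast
  with s(2) m[OF \<delta>] show False by (simp add: field_simps add_eq_0_iff)
qed

section \<open>The vector field\<close>

definition "Hx a t x y z w q p = (2 * x * y * (y - 1) + (a 0 + a 1) * y - a 1) / t"
  for a :: "nat \<Rightarrow> complex" and t x y z w q p :: complex
definition "Hy a t x y z w q p = (x^2 * (2 * y - 1) + x * (a 0 + a 1) + t + 2 * z * (z * w + a 3) - 2 * p) / t"
  for a :: "nat \<Rightarrow> complex" and t x y z w q p :: complex
definition "Hz a t x y z w q p = (2 * z * w * (w - 1) + (a 0 + a 1 + 2 * a 2 + 2 * a 3) * w - a 3
    + 4 * y * z * w + 2 * y * a 3) / t"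
  for a :: "nat \<Rightarrow> complex" and t x y z w q p :: complex
definition "Hw a t x y z w q p = (z^2 * (2 * w - 1) + z * (a 0 + a 1 + 2 * a 2 + 2 * a 3) + t
    + 2 * y * z^2 - 2 * p) / t"
  for a :: "nat \<Rightarrow> complex" and t x y z w q p :: complex
definition "Hq a t x y z w q p = (2 * q * p * (p - t) + (a 5 + a 6 - 1) * p - t * a 5) / t"
  for a :: "nat \<Rightarrow> complex" and t x y z w q p :: complex
definition "Hp a t x y z w q p = (q^2 * (2 * p - t) + q * (a 5 + a 6 - 1) + 1 - 2 * (y + w)) / t"
  for a :: "nat \<Rightarrow> complex" and t x y z w q p :: complex

lemmas H_defs = Hx_def Hy_def Hz_def Hw_def Hq_def Hp_def

lemma deriv_hamiltonian:
  "deriv (\<lambda>u. hamiltonian a t u y z w q p) x = Hx a t x y z w q p"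
  "deriv (\<lambda>u. hamiltonian a t x u z w q p) y = Hy a t x y z w q p"
  "deriv (\<lambda>u. hamiltonian a t x y u w q p) z = Hz a t x y z w q p"
  "deriv (\<lambda>u. hamiltonian a t x y z u q p) w = Hw a t x y z w q p"
  "deriv (\<lambda>u. hamiltonian a t x y z w u p) q = Hq a t x y z w q p"
  "deriv (\<lambda>u. hamiltonian a t x y z w q u) p = Hp a t x y z w q p"
  unfolding hamiltonian_def H_defs
  by (rule DERIV_imp_deriv, rule DERIV_cdivide,
      (auto intro!: derivative_eq_intros simp: algebra_simps power2_eq_square)[1])+

lemma H_cong:
  assumes "\<And>i. i \<le> 6 \<Longrightarrow> a i = b i"
  shows "Hx a t = Hx b t" "Hy a t = Hy b t" "Hz a t = Hz b t" "Hw a t = Hw b t"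
    "Hq a t = Hq b t" "Hp a t = Hp b t"
  using assms by (simp_all add: fun_eq_iff H_defs)

text \<open>The curves are parametrised by \<open>t\<close>, the equations are those at the new time \<open>s\<close>, and \<open>\<epsilon>\<close> is the
derivative of \<open>s\<close> with respect to \<open>t\<close>.\<close>

definition flow_at ::
  "(nat \<Rightarrow> complex) \<Rightarrow> complex \<Rightarrow> (complex \<Rightarrow> complex) \<Rightarrow> (complex \<Rightarrow> complex) \<Rightarrow> (complex \<Rightarrow> complex)
    \<Rightarrow> (complex \<Rightarrow> complex) \<Rightarrow> (complex \<Rightarrow> complex) \<Rightarrow> (complex \<Rightarrow> complex) \<Rightarrow> complex \<Rightarrow> complex \<Rightarrow> bool"
  where
  "flow_at a \<epsilon> x y z w q p t s \<longleftrightarrow>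
    (x has_field_derivative \<epsilon> * Hy a s (x t) (y t) (z t) (w t) (q t) (p t)) (at t) \<and>
    (y has_field_derivative \<epsilon> * (- Hx a s (x t) (y t) (z t) (w t) (q t) (p t))) (at t) \<and>
    (z has_field_derivative \<epsilon> * Hw a s (x t) (y t) (z t) (w t) (q t) (p t)) (at t) \<and>
    (w has_field_derivative \<epsilon> * (- Hz a s (x t) (y t) (z t) (w t) (q t) (p t))) (at t) \<and>
    (q has_field_derivative \<epsilon> * Hp a s (x t) (y t) (z t) (w t) (q t) (p t)) (at t) \<and>
    (p has_field_derivative \<epsilon> * (- Hq a s (x t) (y t) (z t) (w t) (q t) (p t))) (at t)"

lemma solves_iff_flow:
  "solves a S x y z w q p \<longleftrightarrow> normalized a \<and> open S \<and> S \<noteq> {} \<and> 0 \<notin> S \<and>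
    (\<forall>t\<in>S. flow_at a 1 x y z w q p t t)"
  unfolding solves_def flow_at_def deriv_hamiltonian by simp

lemma open_mult_image:
  fixes \<epsilon> :: complex
  assumes "open S" "\<epsilon> * \<epsilon> = 1"
  shows "open ((*) \<epsilon> ` S)"
proof -
  have cancel: "\<epsilon> * (\<epsilon> * s) = s" for s using assms(2) by (simp flip: mult.assoc)
  have "(*) \<epsilon> ` S = (*) \<epsilon> -` S"
    by (auto simp: cancel intro!: image_eqI[where x = "\<epsilon> * _"])
  then show ?thesis using assms(1) by (simp add: continuous_open_vimage)
qed

lemma has_field_derivative_rescale:
  fixes f g :: "complex \<Rightarrow> complex"
  assumes "open S" "t \<in> S" "\<epsilon> * \<epsilon> = 1" and fg: "\<And>s. s \<in> S \<Longrightarrow> g (\<epsilon> * s) = f s"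
    and f: "(f has_field_derivative \<epsilon> * D) (at t)"
  shows "(g has_field_derivative D) (at (\<epsilon> * t))"
proof -
  have cancel: "\<epsilon> * (\<epsilon> * s) = s" for s using assms(3) by (simp flip: mult.assoc)
  have nz: "\<epsilon> \<noteq> 0" using assms(3) by auto
  have "((\<lambda>s. f (\<epsilon> * s)) has_field_derivative (\<epsilon> * D) * \<epsilon>) (at (\<epsilon> * t))"
    by (rule DERIV_chain2[where g = "\<lambda>s. \<epsilon> * s"])
       (use f in \<open>auto simp: cancel intro!: derivative_eq_intros\<close>)
  then have "((\<lambda>s. f (\<epsilon> * s)) has_field_derivative D) (at (\<epsilon> * t))"
    using assms(3) by (simp add: mult.commute mult.left_commute)
  then show ?thesis
  proof (rule has_field_derivative_transform_within_open)
    show "open ((*) \<epsilon> ` S)" by (rule open_mult_image) fact+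
    show "\<epsilon> * t \<in> (*) \<epsilon> ` S" using \<open>t \<in> S\<close> by (rule imageI)
    show "f (\<epsilon> * u) = g u" if "u \<in> (*) \<epsilon> ` S" for u using that fg by (auto simp: cancel)
  qed
qed

text \<open>Here \<open>\<epsilon>\<close> is the sign of the new time. Openness of the domain lets the new functions, known only
pointwise through their values, be differentiated as the formulas that they agree with.\<close>

lemma solves_rescale:
  assumes sol: "solves a S x y z w q p" and \<epsilon>: "\<epsilon> * \<epsilon> = 1" and b: "normalized b"
    and vals: "\<And>t. t \<in> S \<Longrightarrow> \<theta> t = \<epsilon> * t \<and> x' (\<epsilon> * t) = fx t \<and> y' (\<epsilon> * t) = fy t \<and> z' (\<epsilon> * t) = fz t
      \<and> w' (\<epsilon> * t) = fw t \<and> q' (\<epsilon> * t) = fq t \<and> p' (\<epsilon> * t) = fp t"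
    and flow: "\<And>t. t \<in> S \<Longrightarrow> flow_at b \<epsilon> fx fy fz fw fq fp t (\<epsilon> * t)"
  shows "solves b (\<theta> ` S) x' y' z' w' q' p'"
proof -
  have S: "open S" "S \<noteq> {}" "0 \<notin> S" using sol by (auto simp: solves_def)
  have nz: "\<epsilon> \<noteq> 0" using \<epsilon> by auto
  have img: "\<theta> ` S = (*) \<epsilon> ` S" using vals by (intro image_cong) auto
  have "flow_at b 1 x' y' z' w' q' p' (\<epsilon> * t) (\<epsilon> * t)" if "t \<in> S" for t
  proof -
    note rescale = has_field_derivative_rescale[OF S(1) that \<epsilon>]
    note flow = flow[OF that, unfolded flow_at_def]
    show ?thesis
      unfolding flow_at_def mult_1_left
      using rescale[of x' fx] rescale[of y' fy] rescale[of z' fz] rescale[of w' fw]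
        rescale[of q' fq] rescale[of p' fp] flow vals that by simp
  qed
  moreover have "open ((*) \<epsilon> ` S)" using S(1) \<epsilon> by (rule open_mult_image)
  ultimately show ?thesis unfolding solves_iff_flow img using S b nz by auto
qed

section \<open>Transport of solutions\<close>

text \<open>The clause of \<open>backlund\<close> that concerns the differential equations.\<close>

definition transports :: "(ratfun \<Rightarrow> ratfun) \<Rightarrow> bool" where
  "transports \<phi> \<longleftrightarrow>
    (\<forall>a S x y z w q p b \<theta> x' y' z' w' q' p'.
       solves a S x y z w q p \<longrightarrow>
       (\<forall>t\<in>S. let e = point a t (x t) (y t) (z t) (w t) (q t) (p t) in
          has_value (\<phi> tt) e (\<theta> t) \<and>
          has_value (\<phi> xx) e (x' (\<theta> t)) \<and> has_value (\<phi> yy) e (y' (\<theta> t)) \<and>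
          has_value (\<phi> zz) e (z' (\<theta> t)) \<and> has_value (\<phi> ww) e (w' (\<theta> t)) \<and>
          has_value (\<phi> qq) e (q' (\<theta> t)) \<and> has_value (\<phi> pp) e (p' (\<theta> t)) \<and>
          (\<forall>i\<le>6. has_value (\<phi> (alpha i)) e (b i))) \<longrightarrow>
       solves b (\<theta> ` S) x' y' z' w' q' p')"

lemma point_vals:
  assumes "normalized a" and e_def: "e = point a t x y z w q p"
  shows "point.val e xx x" "point.val e yy y" "point.val e zz z" "point.val e ww w"
    "point.val e qq q" "point.val e pp p" "point.val e tt t"
    "point.val e (alpha 0) (a 0)" "point.val e (alpha 1) (a 1)" "point.val e (alpha 2) (a 2)"
    "point.val e (alpha 3) (a 3)" "point.val e (alpha 4) (a 4)" "point.val e (alpha 5) (a 5)"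
    "point.val e (alpha 6) (a 6)"
proof -
  note vals = point.val_coordinates[of e]
  then show "point.val e xx x" "point.val e yy y" "point.val e zz z" "point.val e ww w"
    "point.val e qq q" "point.val e pp p" "point.val e tt t"
    "point.val e (alpha 1) (a 1)" "point.val e (alpha 2) (a 2)" "point.val e (alpha 3) (a 3)"
    "point.val e (alpha 4) (a 4)" "point.val e (alpha 5) (a 5)" "point.val e (alpha 6) (a 6)"
    by (simp_all add: e_def)
  have "point.val e (alpha 0) (1 - e A1 - 2 * e A2 - 2 * e A3 - 2 * e A4 - e A5 - e A6)"
    unfolding alpha_0_eq by (intro point.val_arith vals)
  moreover have "1 - e A1 - 2 * e A2 - 2 * e A3 - 2 * e A4 - e A5 - e A6 = a 0"
    using assms(1) by (simp add: normalized_def e_def algebra_simps)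
  ultimately show "point.val e (alpha 0) (a 0)" by simp
qed

lemma list_vals_unique:
  "list_all2 (point.val e) rs cs \<Longrightarrow> list_all2 (point.val e) rs ds \<Longrightarrow> cs = ds"
  unfolding list_all2_conv_all_nth list_eq_iff_nth_eq using point.val_unique[of e] by metis

text \<open>The denominators of the rows of \<open>images\<close>, apart from \<open>t\<close>, which does not vanish on a domain of solutions.\<close>

definition denominator ::
  "nat \<Rightarrow> complex \<Rightarrow> complex \<Rightarrow> complex \<Rightarrow> complex \<Rightarrow> complex \<Rightarrow> complex \<Rightarrow> complex \<Rightarrow> complex"
  where
  "denominator k x y z w q p t = [y - 1, y, x - z, w, z * q - 1, p, p - t, 1, z, 1, 1] ! k"

definition time_sign :: "nat \<Rightarrow> complex" where
  "time_sign k = (if k < 9 then 1 else - 1)"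

text \<open>If the parameter \<open>\<alpha>\<^sub>i\<close> vanishes at \<open>e\<close>, numerator and denominator of \<open>\<alpha>\<^sub>i / f\<^sub>i\<close> may vanish together, and
regularity does not exclude \<open>f\<^sub>i = 0\<close> by evaluation at \<open>e\<close> alone. Moving \<open>\<alpha>\<^sub>i\<close> away from
\<open>0\<close> while \<open>f\<^sub>i\<close> stays \<open>0\<close> does; \<open>\<alpha>\<^sub>0\<close> is moved through \<open>\<alpha>\<^sub>1\<close>, and for \<open>t / z\<close> the time is moved.\<close>

lemma denominator_nonzero:
  assumes e: "e = point a t x y z w q p"
  shows "point.val e (xx + alpha 0 / (yy - 1)) c \<Longrightarrow> y - 1 \<noteq> 0"
    "point.val e (xx + alpha 1 / yy) c \<Longrightarrow> y \<noteq> 0"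
    "point.val e (yy - alpha 2 / (xx - zz)) c \<Longrightarrow> x - z \<noteq> 0"
    "point.val e (zz + alpha 3 / ww) c \<Longrightarrow> w \<noteq> 0"
    "point.val e (ww - alpha 4 * qq / (zz * qq - 1)) c \<Longrightarrow> z * q - 1 \<noteq> 0"
    "point.val e (qq + alpha 5 / pp) c \<Longrightarrow> p \<noteq> 0"
    "point.val e (qq + alpha 6 / (pp - tt)) c \<Longrightarrow> p - t \<noteq> 0"
    "point.val e (tt / zz) c \<Longrightarrow> z \<noteq> 0"
proof -
  show "y - 1 \<noteq> 0" if "point.val e (xx + alpha 0 / (yy - 1)) c"
    using that
    by (rule regular_imp_denominator_nonzero[where v = A1 and d = "yy - 1"
          and n = "xx * (yy - 1) + alpha 0"
          and k = "x * (y - 1) + (1 - 2 * a 2 - 2 * a 3 - 2 * a 4 - a 5 - a 6)" and m = "- 1"])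
       (use nonzero nonzero' in \<open>simp add: field_simps\<close>,
        ((unfold alpha_0_eq)?, rule point.val_eqI,
          (rule point.val_arith point.val_coordinates)+, simp add: e algebra_simps)+,
        use nonzero in auto)
  show "y \<noteq> 0" if "point.val e (xx + alpha 1 / yy) c"
    using that
    by (rule regular_imp_denominator_nonzero[where v = A1 and d = "yy"
          and n = "xx * yy + alpha 1"
          and k = "x * y" and m = "1"])
       (use nonzero nonzero' in \<open>simp add: field_simps\<close>,
        ((unfold alpha_0_eq)?, rule point.val_eqI,
          (rule point.val_arith point.val_coordinates)+, simp add: e algebra_simps)+,
        use nonzero in auto)
  show "x - z \<noteq> 0" if "point.val e (yy - alpha 2 / (xx - zz)) c"
    using that
    by (rule regular_imp_denominator_nonzero[where v = A2 and d = "xx - zz"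
          and n = "yy * (xx - zz) - alpha 2"
          and k = "y * (x - z)" and m = "- 1"])
       (use nonzero nonzero' in \<open>simp add: field_simps\<close>,
        ((unfold alpha_0_eq)?, rule point.val_eqI,
          (rule point.val_arith point.val_coordinates)+, simp add: e algebra_simps)+,
        use nonzero in auto)
  show "w \<noteq> 0" if "point.val e (zz + alpha 3 / ww) c"
    using that
    by (rule regular_imp_denominator_nonzero[where v = A3 and d = "ww"
          and n = "zz * ww + alpha 3"
          and k = "z * w" and m = "1"])
       (use nonzero nonzero' in \<open>simp add: field_simps\<close>,
        ((unfold alpha_0_eq)?, rule point.val_eqI,
          (rule point.val_arith point.val_coordinates)+, simp add: e algebra_simps)+,
        use nonzero in auto)
  show "z * q - 1 \<noteq> 0" if "point.val e (ww - alpha 4 * qq / (zz * qq - 1)) c"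
    using that
    by (rule regular_imp_denominator_nonzero[where v = A4 and d = "zz * qq - 1"
          and n = "ww * (zz * qq - 1) - alpha 4 * qq"
          and k = "w * (z * q - 1)" and m = "- q"])
       (use nonzero nonzero' in \<open>simp add: field_simps\<close>,
        ((unfold alpha_0_eq)?, rule point.val_eqI,
          (rule point.val_arith point.val_coordinates)+, simp add: e algebra_simps)+,
        use nonzero in auto)
  show "p \<noteq> 0" if "point.val e (qq + alpha 5 / pp) c"
    using that
    by (rule regular_imp_denominator_nonzero[where v = A5 and d = "pp"
          and n = "qq * pp + alpha 5"
          and k = "q * p" and m = "1"])
       (use nonzero nonzero' in \<open>simp add: field_simps\<close>,
        ((unfold alpha_0_eq)?, rule point.val_eqI,
          (rule point.val_arith point.val_coordinates)+, simp add: e algebra_simps)+,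
        use nonzero in auto)
  show "p - t \<noteq> 0" if "point.val e (qq + alpha 6 / (pp - tt)) c"
    using that
    by (rule regular_imp_denominator_nonzero[where v = A6 and d = "pp - tt"
          and n = "qq * (pp - tt) + alpha 6"
          and k = "q * (p - t)" and m = "1"])
       (use nonzero nonzero' in \<open>simp add: field_simps\<close>,
        ((unfold alpha_0_eq)?, rule point.val_eqI,
          (rule point.val_arith point.val_coordinates)+, simp add: e algebra_simps)+,
        use nonzero in auto)
  show "z \<noteq> 0" if "point.val e (tt / zz) c"
    using that
    by (rule regular_imp_denominator_nonzero[where v = T and d = "zz"
          and n = "tt"
          and k = "0" and m = "1"])
       (use nonzero nonzero' in \<open>simp add: field_simps\<close>,
        ((unfold alpha_0_eq)?, rule point.val_eqI,
          (rule point.val_arith point.val_coordinates)+, simp add: e algebra_simps)+,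
        use nonzero in auto)
qed

lemma flow_at_oneD:
  assumes "flow_at a 1 x y z w q p t s"
  shows "(x has_field_derivative Hy a s (x t) (y t) (z t) (w t) (q t) (p t)) (at t)"
    "(y has_field_derivative - Hx a s (x t) (y t) (z t) (w t) (q t) (p t)) (at t)"
    "(z has_field_derivative Hw a s (x t) (y t) (z t) (w t) (q t) (p t)) (at t)"
    "(w has_field_derivative - Hz a s (x t) (y t) (z t) (w t) (q t) (p t)) (at t)"
    "(q has_field_derivative Hp a s (x t) (y t) (z t) (w t) (q t) (p t)) (at t)"
    "(p has_field_derivative - Hq a s (x t) (y t) (z t) (w t) (q t) (p t)) (at t)"
  using assms by (simp_all add: flow_at_def)

text \<open>Differentiating the formulas and inserting the equations of the given solution leaves, for each of
the six functions, an identity between rational functions of the values, the time and the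
parameters. It is one of polynomials after multiplication by powers of \<open>t\<close> and of the denominator,
and after elimination of \<open>\<alpha>\<^sub>6\<close> by the normalization.\<close>

lemma flow_images:
  assumes k: "k < 11" and flow: "flow_at a 1 x y z w q p t t" and norm: "normalized a" and t: "t \<noteq> 0"
    and nz: "denominator k (x t) (y t) (z t) (w t) (q t) (p t) t \<noteq> 0"
  defines "F \<equiv> \<lambda>t. images (x t) (y t) (z t) (w t) (q t) (p t) t a ! k"
  shows "flow_at (\<lambda>i. F t ! (i + 7)) (time_sign k) (\<lambda>t. F t ! 0) (\<lambda>t. F t ! 1) (\<lambda>t. F t ! 2)
    (\<lambda>t. F t ! 3) (\<lambda>t. F t ! 4) (\<lambda>t. F t ! 5) t (time_sign k * t)"
proof -
  note D = flow_at_oneD[OF flow]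
  have a6: "a 6 = 1 - a 0 - a 1 - 2 * a 2 - 2 * a 3 - 2 * a 4 - a 5"
    using norm by (simp add: normalized_def algebra_simps)
  show ?thesis
    using k nz unfolding F_def
    by (elim less_11_cases; hypsubst)
       (simp add: flow_at_def images_def time_sign_def denominator_def,
        intro conjI; rule DERIV_cong, ((rule derivative_intros D | simp add: t; fail)+)?;
        (simp add: H_defs divide_simps t)?; (simp add: algebra_simps power2_eq_square a6)?)+
qed

lemma val_images:
  assumes k: "k < 11" and norm: "normalized a" and t: "t \<noteq> 0"
    and nz: "denominator k x y z w q p t \<noteq> 0"
  shows "list_all2 (point.val (point a t x y z w q p)) (gen_images ! k) (images x y z w q p t a ! k)"
  using k nz
  by (elim less_11_cases; hypsubst)
     (use t in \<open>auto simp: gen_images_defs denominator_def simp del: One_nat_def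
        intro!: point.val_arith point_vals[OF norm]\<close>)

lemma denominator_nonzero_gen:
  assumes k: "k < 11" and reg: "list_all2 (point.val (point a t x y z w q p)) (gen_images ! k) cs"
  shows "denominator k x y z w q p t \<noteq> 0"
proof -
  have *: "\<exists>c. point.val (point a t x y z w q p) (gen_images ! k ! i) c" if "i < length (gen_images ! k)" for i
    using list_all2_nthD[OF reg that] by blast
  note dest = denominator_nonzero[OF refl, of a t x y z w q p]
  show ?thesis using k *[of 0] *[of 1] *[of 2] *[of 3] *[of 4]
    by (elim less_11_cases; hypsubst)
       (simp add: gen_images_defs denominator_def del: right_minus_eq One_nat_def,
        ((elim exE)?; rule dest; assumption)?)+
qed

lemma time_sign_square: "time_sign k * time_sign k = 1"
  by (simp add: time_sign_def)

lemma images_time: "k < 11 \<Longrightarrow> images x y z w q p t a ! k ! 6 = time_sign k * t"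
  by (erule less_11_cases; simp add: images_def time_sign_def)

lemma images_normalized:
  assumes "k < 11" "normalized a"
  shows "normalized (\<lambda>i. images x y z w q p t a ! k ! (i + 7))"
  using assms by (elim less_11_cases; simp add: images_def normalized_def algebra_simps)

text \<open>Regularity gives nonvanishing denominators, uniqueness of values then identifies the new functions with the
formulas of \<open>images\<close>, and for these the equations hold by \<open>flow_images\<close>.\<close>

lemma transports_gen:
  assumes k: "k < 11"
  shows "transports (gen k)"
  unfolding transports_def Let_def
proof (intro allI impI)
  fix a S x y z w q p b \<theta> x' y' z' w' q' p'
  assume sol: "solves a S x y z w q p"
  let ?F = "\<lambda>t. images (x t) (y t) (z t) (w t) (q t) (p t) t a ! k"
  let ?e = "\<lambda>t. point a t (x t) (y t) (z t) (w t) (q t) (p t)"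
  let ?r = "gen k"
  assume hyp: "\<forall>t\<in>S. has_value (?r tt) (?e t) (\<theta> t) \<and>
          has_value (?r xx) (?e t) (x' (\<theta> t)) \<and> has_value (?r yy) (?e t) (y' (\<theta> t)) \<and>
          has_value (?r zz) (?e t) (z' (\<theta> t)) \<and> has_value (?r ww) (?e t) (w' (\<theta> t)) \<and>
          has_value (?r qq) (?e t) (q' (\<theta> t)) \<and> has_value (?r pp) (?e t) (p' (\<theta> t)) \<and>
          (\<forall>i\<le>6. has_value (?r (alpha i)) (?e t) (b i))"
  have S: "normalized a" "S \<noteq> {}" "0 \<notin> S" and fl: "t \<in> S \<Longrightarrow> flow_at a 1 x y z w q p t t" for t
    using sol by (auto simp: solves_iff_flow)
  have all: "list_all2 (point.val (?e t)) (gen_images ! k)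
      [x' (\<theta> t), y' (\<theta> t), z' (\<theta> t), w' (\<theta> t), q' (\<theta> t), p' (\<theta> t), \<theta> t,
       b 0, b 1, b 2, b 3, b 4, b 5, b 6]"
    if "t \<in> S" for t
    unfolding map_gen_coords[OF k, symmetric] using hyp that
    by (simp add: coords_def has_value_eq)
  have nz: "t \<noteq> 0" "denominator k (x t) (y t) (z t) (w t) (q t) (p t) t \<noteq> 0" if "t \<in> S" for t
    using that S(3) denominator_nonzero_gen[OF k all[OF that]] by auto
  have F: "?F t = [x' (\<theta> t), y' (\<theta> t), z' (\<theta> t), w' (\<theta> t), q' (\<theta> t), p' (\<theta> t), \<theta> t,
       b 0, b 1, b 2, b 3, b 4, b 5, b 6]"
    if "t \<in> S" for t
    using val_images[OF k S(1) nz[OF that]] all[OF that] by (rule list_vals_unique)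
  have \<theta>: "\<theta> t = time_sign k * t" if "t \<in> S" for t
    using images_time[OF k, of "x t" "y t" "z t" "w t" "q t" "p t" t a] F[OF that] by simp
  have b: "?F t ! (i + 7) = b i" if "t \<in> S" "i \<le> 6" for t i
  proof -
    have "i = 0 \<or> i = 1 \<or> i = 2 \<or> i = 3 \<or> i = 4 \<or> i = 5 \<or> i = 6" using that by presburger
    then show ?thesis using F[OF that(1)] by auto
  qed
  show "solves b (\<theta> ` S) x' y' z' w' q' p'"
  proof (rule solves_rescale[OF sol time_sign_square, where fx = "\<lambda>t. ?F t ! 0" and fy = "\<lambda>t. ?F t ! 1"
        and fz = "\<lambda>t. ?F t ! 2" and fw = "\<lambda>t. ?F t ! 3" and fq = "\<lambda>t. ?F t ! 4" and fp = "\<lambda>t. ?F t ! 5"])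
    obtain t where t: "t \<in> S" using S by auto
    show "normalized b" using images_normalized[OF k S(1), of "x t" "y t" "z t" "w t" "q t" "p t" t]
        b[OF t, of 0] b[OF t, of 1] b[OF t, of 2] b[OF t, of 3] b[OF t, of 4] b[OF t, of 5] b[OF t, of 6]
      unfolding normalized_def by simp
  next
    fix t assume t: "t \<in> S"
    show "\<theta> t = time_sign k * t \<and> x' (time_sign k * t) = ?F t ! 0
      \<and> y' (time_sign k * t) = ?F t ! 1 \<and> z' (time_sign k * t) = ?F t ! 2
      \<and> w' (time_sign k * t) = ?F t ! 3
      \<and> q' (time_sign k * t) = ?F t ! 4 \<and> p' (time_sign k * t) = ?F t ! 5"
      using F[OF t] \<theta>[OF t] by simp
    have cong: "i \<le> 6 \<Longrightarrow> b i = ?F t ! (i + 7)" for i using b[OF t] by simp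
    show "flow_at b (time_sign k) (\<lambda>t. ?F t ! 0) (\<lambda>t. ?F t ! 1) (\<lambda>t. ?F t ! 2) (\<lambda>t. ?F t ! 3) (\<lambda>t. ?F t ! 4)
        (\<lambda>t. ?F t ! 5) t (time_sign k * t)"
      using flow_images[OF k fl[OF t] S(1) nz[OF t]]
      by (simp only: flow_at_def H_cong[where b = "\<lambda>i. ?F t ! (i + 7)", OF cong])
  qed
qed

definition affine :: "ratfun \<Rightarrow> bool" where
  "affine r \<longleftrightarrow> (\<exists>c k. r = rconst c + (\<Sum>j\<le>6. rconst (k j) * alpha j))"

lemma affine_alpha: "i \<le> 6 \<Longrightarrow> affine (alpha i)"
proof -
  assume "i \<le> 6"
  have "(\<Sum>j\<le>6. rconst (if j = i then 1 else 0) * alpha j) = (\<Sum>j\<le>6. if j = i then alpha j else 0)"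
    by (intro sum.cong) (simp_all add: const.kappa_zero const.kappa_one)
  also have "\<dots> = alpha i" using \<open>i \<le> 6\<close> by (simp add: sum.delta)
  finally show ?thesis unfolding affine_def
    by (intro exI[of _ 0] exI[of _ "\<lambda>j. if j = i then 1 else 0"]) (simp add: const.kappa_zero)
qed

lemma affine_add:
  assumes "affine r" "affine s"
  shows "affine (r + s)"
proof -
  obtain c k d l where "r = rconst c + (\<Sum>j\<le>6. rconst (k j) * alpha j)"
    "s = rconst d + (\<Sum>j\<le>6. rconst (l j) * alpha j)"
    using assms unfolding affine_def by blast
  then have "r + s = rconst (c + d) + (\<Sum>j\<le>6. rconst (k j + l j) * alpha j)"
    by (simp add: const.kappa_add distrib_right sum.distrib)
  then show ?thesis unfolding affine_def by (intro exI[of _ "c + d"] exI[of _ "\<lambda>j. k j + l j"])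
qed

lemma affine_uminus:
  assumes "affine r"
  shows "affine (- r)"
proof -
  have uminus: "rconst (- c) = - rconst c" for c
    using const.kappa_add[of c "- c"] by (simp add: const.kappa_zero eq_neg_iff_add_eq_0 add.commute)
  obtain c k where "r = rconst c + (\<Sum>j\<le>6. rconst (k j) * alpha j)"
    using assms unfolding affine_def by blast
  then have "- r = rconst (- c) + (\<Sum>j\<le>6. rconst (- k j) * alpha j)"
    by (simp add: uminus sum_negf)
  then show ?thesis unfolding affine_def by (intro exI[of _ "- c"] exI[of _ "\<lambda>j. - k j"])
qed

lemma affine_gen:
  assumes "k < 11" "i \<le> 6"
  shows "affine (gen k (alpha i))"
proof -
  have i: "i = 0 \<or> i = 1 \<or> i = 2 \<or> i = 3 \<or> i = 4 \<or> i = 5 \<or> i = 6" using assms(2) by presburger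
  show ?thesis using assms(1)
    by (elim less_11_cases; hypsubst)
       (use i in \<open>elim disjE; simp add: gen_simps affine_add affine_uminus affine_alpha\<close>)+
qed

lemma backlund_gen:
  assumes k: "k < 11"
  shows "backlund (gen k)"
proof -
  have "gen k tt = tt \<or> gen k tt = - tt"
    using k by (elim less_11_cases; simp add: gen_simps)
  then show ?thesis
    using field_aut_gen[OF k] affine_gen[OF k] transports_gen[OF k]
    unfolding backlund_def affine_def transports_def by blast
qed

section \<open>The symmetry group\<close>

lemma D6_relations_gen: "D6_relations gen"
proof -
  have inv: "gen i (gen i r) = r" if "i \<le> 6" for i r
    using gen_gen[of i] that by (simp add: fun_eq_iff)
  have three: "(gen i \<circ> gen j) ^^ 3 = id"
    if "i \<le> 6" "j \<le> 6" and braid: "gen i \<circ> gen j \<circ> gen i = gen j \<circ> gen i \<circ> gen j" for i j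
  proof
    fix r
    have "gen i (gen j (gen i s)) = gen j (gen i (gen j s))" for s
      using braid by (simp add: fun_eq_iff)
    then show "((gen i \<circ> gen j) ^^ 3) r = id r"
      using that(1,2) by (simp add: eval_nat_numeral inv)
  qed
  have two: "(gen i \<circ> gen j) ^^ 2 = id"
    if "i \<le> 6" "j \<le> 6" and comm: "gen i \<circ> gen j = gen j \<circ> gen i" for i j
  proof
    fix r
    have "gen i (gen j s) = gen j (gen i s)" for s
      using comm by (simp add: fun_eq_iff)
    then show "((gen i \<circ> gen j) ^^ 2) r = id r"
      using that(1,2) by (simp add: eval_nat_numeral inv)
  qed
  note braids = braid_0_2 braid_1_2 braid_2_3 braid_3_4 braid_4_5 braid_4_6
  have cases: "i = 0 \<or> i = 1 \<or> i = 2 \<or> i = 3 \<or> i = 4 \<or> i = 5 \<or> i = 6" if "i \<le> 6" for i :: nat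
    using that by presburger
  have adj: "gen i \<circ> gen j \<circ> gen i = gen j \<circ> gen i \<circ> gen j" if "D6_adj i j" for i j
    using that unfolding D6_adj_def Let_def by (auto simp: braids[unfolded One_nat_def])
  have nonadj: "gen i \<circ> gen j = gen j \<circ> gen i" if "i \<le> 6" "j \<le> 6" "i \<noteq> j" "\<not> D6_adj i j" for i j
    using cases[OF that(1)] cases[OF that(2)] that(3,4)
    by (elim disjE; simp add: D6_adj_def gen_commute[unfolded One_nat_def])
  show ?thesis
    unfolding D6_relations_def
  proof (intro conjI allI impI)
    show "gen i ^^ 2 = id" if "i \<le> 6" for i
      using gen_gen[of i] that by (simp add: numeral_2_eq_2)
    show "(gen i \<circ> gen j) ^^ 3 = id" if "i \<le> 6" "j \<le> 6" "D6_adj i j" for i j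
      using three[OF that(1,2) adj[OF that(3)]] .
    show "(gen i \<circ> gen j) ^^ 2 = id" if "i \<le> 6" "j \<le> 6" "i \<noteq> j \<and> \<not> D6_adj i j" for i j
      using two[OF that(1,2) nonadj[OF that(1,2)]] that(3) by blast
  qed
qed

lemma D6_diagram_aut_diagram_perm:
  assumes "j \<in> {1..4}"
  shows "D6_diagram_aut (diagram_perm j)"
proof -
  have j: "j = 1 \<or> j = 2 \<or> j = 3 \<or> j = 4" using assms by auto
  have le: "diagram_perm j i \<le> 6" "diagram_perm j (diagram_perm j i) = i" if "i \<le> 6" for i
    using that by (auto simp: diagram_perm_def)
  have "bij_betw (diagram_perm j) {..6} {..6}"
    by (rule bij_betwI[where g = "diagram_perm j"]) (use le in auto)
  moreover have "D6_adj (diagram_perm j i) (diagram_perm j l) \<longleftrightarrow> D6_adj i l" if "i \<le> 6" "l \<le> 6" for i l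
  proof -
    have cases: "i = 0 \<or> i = 1 \<or> i = 2 \<or> i = 3 \<or> i = 4 \<or> i = 5 \<or> i = 6" if "i \<le> 6" for i :: nat
      using that by presburger
    show ?thesis using j cases[OF that(1)] cases[OF that(2)]
      by (elim disjE; hypsubst; simp add: D6_adj_def diagram_perm_def)
  qed
  ultimately show ?thesis unfolding D6_diagram_aut_def by blast
qed

lemma conj_gen:
  assumes "j \<in> {1..4}" "i \<le> 6"
  shows "gen (j + 6) \<circ> gen i \<circ> inv (gen (j + 6)) = gen (diagram_perm j i)"
proof -
  have inv: "gen (j + 6) \<circ> gen (j + 6) = id" by (rule gen_gen) (use assms in auto)
  then have "inv (gen (j + 6)) = gen (j + 6)" by (metis inv_unique_comp)
  then show ?thesis using inv by (simp add: gen_conj[OF assms] comp_assoc)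
qed

theorem theorem2p1:
  shows "\<exists>s \<pi> :: nat \<Rightarrow> ratfun \<Rightarrow> ratfun.
    map (s 0) coords =
      [xx + alpha 0 / (yy - 1), yy, zz, ww, qq, pp, tt,
       - alpha 0, alpha 1, alpha 2 + alpha 0, alpha 3, alpha 4, alpha 5, alpha 6] \<and>
    map (s 1) coords =
      [xx + alpha 1 / yy, yy, zz, ww, qq, pp, tt,
       alpha 0, - alpha 1, alpha 2 + alpha 1, alpha 3, alpha 4, alpha 5, alpha 6] \<and>
    map (s 2) coords =
      [xx, yy - alpha 2 / (xx - zz), zz, ww + alpha 2 / (xx - zz), qq, pp, tt,
       alpha 0 + alpha 2, alpha 1 + alpha 2, - alpha 2, alpha 3 + alpha 2, alpha 4, alpha 5, alpha 6] \<and>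
    map (s 3) coords =
      [xx, yy, zz + alpha 3 / ww, ww, qq, pp, tt,
       alpha 0, alpha 1, alpha 2 + alpha 3, - alpha 3, alpha 4 + alpha 3, alpha 5, alpha 6] \<and>
    map (s 4) coords =
      [xx, yy, zz, ww - alpha 4 * qq / (zz * qq - 1), qq, pp - alpha 4 * zz / (zz * qq - 1), tt,
       alpha 0, alpha 1, alpha 2, alpha 3 + alpha 4, - alpha 4, alpha 5 + alpha 4, alpha 6 + alpha 4] \<and>
    map (s 5) coords =
      [xx, yy, zz, ww, qq + alpha 5 / pp, pp, tt,
       alpha 0, alpha 1, alpha 2, alpha 3, alpha 4 + alpha 5, - alpha 5, alpha 6] \<and>
    map (s 6) coords =
      [xx, yy, zz, ww, qq + alpha 6 / (pp - tt), pp, tt,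
       alpha 0, alpha 1, alpha 2, alpha 3, alpha 4 + alpha 6, alpha 5, - alpha 6] \<and>
    map (\<pi> 1) coords =
      [- xx, 1 - yy, - zz, - ww, - qq, tt - pp, tt,
       alpha 1, alpha 0, alpha 2, alpha 3, alpha 4, alpha 6, alpha 5] \<and>
    map (\<pi> 2) coords =
      [tt * qq, pp / tt, tt / zz, - ((zz * ww + alpha 3) * zz / tt), xx / tt, tt * yy, tt,
       alpha 6, alpha 5, alpha 4, alpha 3, alpha 2, alpha 1, alpha 0] \<and>
    map (\<pi> 3) coords =
      [xx, yy, zz, ww, qq, pp - tt, - tt,
       alpha 0, alpha 1, alpha 2, alpha 3, alpha 4, alpha 6, alpha 5] \<and>
    map (\<pi> 4) coords =
      [- xx, 1 - yy, - zz, - ww, - qq, - pp, - tt,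
       alpha 1, alpha 0, alpha 2, alpha 3, alpha 4, alpha 5, alpha 6] \<and>
    (\<forall>i\<le>6. backlund (s i)) \<and>
    (\<forall>j\<in>{1..4}. backlund (\<pi> j)) \<and>
    D6_relations s \<and>
    (\<forall>j\<in>{1..4}. D6_diagram_aut (diagram_perm j) \<and>
       (\<forall>i\<le>6. \<pi> j \<circ> s i \<circ> inv (\<pi> j) = s (diagram_perm j i)))"
  by (rule exI[of _ gen], rule exI[of _ "\<lambda>j. gen (j + 6)"])
     (use backlund_gen D6_relations_gen D6_diagram_aut_diagram_perm conj_gen in
       \<open>auto simp: map_gen_coords gen_images_defs\<close>)

end
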